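(* Every orthogonal polyhedron with $f$ faces can be guarded by $\lfloor f/6\rfloor$ open face guards. Moreover, this is tight: there exist orthogonal polyhedra with arbitrarily large numbers $f$ of faces that cannot be guarded by fewer than $\lfloor f/6\rfloor$ open face guards.
   Context: A polyhedron is a connected subset of $\mathbb R^3$ that is a union of finitely many closed tetrahedra and whose boundary is a (possibly non-connected) orientable 2-manifold. A face is a maximal planar subset of the boundary with connected, non-empty relative interior. A point $x$ is visible to $y$ if no point of segment $xy$ lies in the exterior of the polyhedron; a set $S$ guards the polyhedron if every point of the polyhedron is visible to some point of $S$. An open face guard is the relative interior of a face; a set of open face guards guards the polyhedron if their union does. A polyhedron is orthogonal if every face is orthogonal to one of the three coordinate axes. *)

theory Defs
  imports "HOL-Analysis.Analysis"
begin

definition tetrahedron :: "(real^3) set \<Rightarrow> bool" where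
  "tetrahedron T \<longleftrightarrow>
     (\<exists>V. finite V \<and> card V = 4 \<and> \<not> affine_dependent V \<and> T = convex hull V)"

definition two_manifold :: "(real^3) set \<Rightarrow> bool" where
  "two_manifold M \<longleftrightarrow>
     (\<forall>x\<in>M. \<exists>U. openin (top_of_set M) U \<and> x \<in> U \<and> U homeomorphic (ball (0::real^2) 1))"

definition polyhedron :: "(real^3) set \<Rightarrow> bool" where
  "polyhedron P \<longleftrightarrow>
     connected P \<and>
     (\<exists>\<T>. finite \<T> \<and> (\<forall>T\<in>\<T>. tetrahedron T) \<and> P = \<Union>\<T>) \<and>
     two_manifold (frontier P)"

definition face_candidate :: "(real^3) set \<Rightarrow> (real^3) set \<Rightarrow> bool" where
  "face_candidate P F \<longleftrightarrow>
     F \<subseteq> frontier P \<and> aff_dim F = 2 \<and>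
     rel_interior F \<noteq> {} \<and> connected (rel_interior F) \<and>
     F = closure (rel_interior F)"

definition faces :: "(real^3) set \<Rightarrow> (real^3) set set" where
  "faces P = {F. face_candidate P F \<and> (\<forall>F'. face_candidate P F' \<and> F \<subseteq> F' \<longrightarrow> F' = F)}"

definition orthogonal_polyhedron :: "(real^3) set \<Rightarrow> bool" where
  "orthogonal_polyhedron P \<longleftrightarrow>
     polyhedron P \<and> (\<forall>F\<in>faces P. \<exists>i::3. \<exists>c::real. F \<subseteq> {x. x $ i = c})"

definition visible :: "(real^3) set \<Rightarrow> real^3 \<Rightarrow> real^3 \<Rightarrow> bool" where
  "visible P x y \<longleftrightarrow> closed_segment x y \<subseteq> P"

definition guards :: "(real^3) set \<Rightarrow> (real^3) set \<Rightarrow> bool" where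
  "guards P S \<longleftrightarrow> (\<forall>p\<in>P. \<exists>s\<in>S. visible P p s)"

definition guarded_by_open_faces :: "(real^3) set \<Rightarrow> (real^3) set set \<Rightarrow> bool" where
  "guarded_by_open_faces P G \<longleftrightarrow> G \<subseteq> faces P \<and> guards P (\<Union>F\<in>G. rel_interior F)"

end

theory Submission
  imports Defs "HOL-Analysis.Analysis"
begin

text \<open>
  Upper bound: a ray parallel to a coordinate axis that starts at a generic point near \<open>p\<close> first leaves the
  polyhedron through a face whose outer normal points in the direction of the ray, and everything the
  ray has swept out together with \<open>p\<close> lies in a box inside the polyhedron. So for each of the six
  directions, the faces with that outer normal guard everything, and the smallest of these six classes
  has at most a sixth of the faces.

  Lower bound: a slab with \<open>k\<close> L-shaped arms has \<open>6 k + 6\<close> faces, and there are \<open>k + 1\<close> points, one on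
  the slab and one on each arm, no two of which are visible from the same open face. That it has at least
  \<open>6 k + 6\<close> faces follows from the upper bound.
\<close>

text \<open>Orthogonality speaks about faces, and faces are only given as maximal planar pieces of
  the boundary, so neither their finiteness nor the fact that they fill the boundary is available at
  the start. Both come from one finite set \<open>C\<close> of coordinate values such that every
  boundary point has some coordinate in \<open>C\<close>. A ray along an axis whose other
  coordinates avoid \<open>C\<close> meets the boundary only where a single plane of the arrangement
  passes, hence in the relative interior of a face, as open guards require.

  In the lower bound every arm has to add six faces and no more. Its top is flush with the top of
  the slab and merges with it, and it leaves the lower half of the slab's right side free, so that
  this side remains one connected face around all arms. What is new is the bottom, two L-shaped
  sides, the outer end, and the top and inner wall of the post.\<close>

section \<open>Existence, uniqueness and counting of faces\<close>

text \<open>The face is the closure of a component \<open>C\<close> of the interior of the boundary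
  relative to \<open>H\<close>. Components of a relatively open subset of a plane are relatively
  open, which makes \<open>C\<close> the full relative interior of its closure and yields
  maximality.\<close>

lemma face_exists:
  fixes H :: "(real^3) set"
  assumes H: "affine H" "aff_dim H = 2" and UH: "openin (top_of_set H) U" and U: "U \<subseteq> frontier P"
    "connected U" "U \<noteq> {}"
  obtains F where "F \<in> faces P" "U \<subseteq> rel_interior F" "F \<subseteq> H"
proof -
  define W where "W = \<Union>{V. openin (top_of_set H) V \<and> V \<subseteq> frontier P}"
  have W: "openin (top_of_set H) W" "W \<subseteq> frontier P"
    unfolding W_def by auto
  have UW: "U \<subseteq> W" using UH U unfolding W_def by auto
  obtain u where u: "u \<in> U" using U by auto
  define C where "C = connected_component_set W u"
  have CH: "openin (top_of_set H) C"
    unfolding C_def using W(1) u UW H(1)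
    by (metis affine_imp_convex convex_imp_locally_connected locally_connected_open_connected_component subsetD)
  have CW: "C \<subseteq> W" and UC: "U \<subseteq> C" and conC: "connected C"
    unfolding C_def using u UW U by (auto simp: connected_component_subset connected_component_maximal)
  have Cmax: "V \<subseteq> C" if "openin (top_of_set H) V" "V \<subseteq> frontier P" "connected V" "u \<in> V" for V
    using that unfolding C_def W_def by (intro connected_component_maximal) auto
  have Cne: "C \<noteq> {}" using UC U by auto
  have affC: "affine hull C = H"
    using CH Cne H(1) affine_hull_openin[of H C] by (simp add: hull_same)
  define F where "F = closure C"
  have affF: "affine hull F = H" unfolding F_def by (simp add: affC)
  have CF: "C \<subseteq> rel_interior F"
    by (rule rel_interior_maximal) (use affF CH closure_subset F_def in auto)
  have FP: "F \<subseteq> frontier P"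
    unfolding F_def using CW W(2) by (intro closure_minimal) auto
  \<comment> \<open>A set between a connected set and its closure is connected; hence
    \<open>rel_interior F\<close> is one of the sets that \<open>Cmax\<close> puts back into
    \<open>C\<close>.\<close>
  have conF: "connected (rel_interior F)"
    by (rule connected_intermediate_closure[OF conC CF]) (use rel_interior_subset F_def in auto)
  have riF: "rel_interior F = C"
    using Cmax[of "rel_interior F"] openin_rel_interior[of F] rel_interior_subset[of F] FP conF CF UC u
    unfolding affF by blast
  have cand: "face_candidate P F"
    unfolding face_candidate_def using FP riF Cne conC H(2) affF
    by (metis F_def aff_dim_affine_hull)
  have "F' = F" if F': "face_candidate P F'" "F \<subseteq> F'" for F'
  proof -
    have "affine hull F' = H"
      using that H(2) affF unfolding face_candidate_def
      by (metis aff_dim_affine_hull aff_dim_eq_full_gen)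
    then have op: "openin (top_of_set H) (rel_interior F')"
      using openin_rel_interior[of F'] by simp
    have "C \<subseteq> rel_interior F'"
      by (rule rel_interior_maximal) (use \<open>affine hull F' = H\<close> CH F'(2) F_def closure_subset in auto)
    then have "rel_interior F' \<subseteq> C"
      using Cmax[OF op] F'(1) rel_interior_subset[of F'] UC u unfolding face_candidate_def by blast
    then have "F' \<subseteq> F"
      using F'(1) unfolding face_candidate_def F_def by (metis closure_mono)
    then show ?thesis using F'(2) by auto
  qed
  then have "F \<in> faces P" using cand unfolding faces_def by auto
  moreover have "F \<subseteq> H" using affF hull_subset by metis
  ultimately show ?thesis using that UC riF by auto
qed

lemma faceD:
  assumes "F \<in> faces P"
  shows "F \<subseteq> frontier P" "aff_dim F = 2" "rel_interior F \<noteq> {}" "connected (rel_interior F)"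
    "F = closure (rel_interior F)"
  using assms unfolding faces_def face_candidate_def by auto

text \<open>The union of the two relative interiors with \<open>W\<close> is connected and
  relatively open, so a single face contains it; maximality identifies that face with both.\<close>

lemma face_eqI:
  assumes F: "F1 \<in> faces P" "F2 \<in> faces P" and aff: "affine hull F1 = affine hull F2"
    and W: "openin (top_of_set (affine hull F1)) W" "W \<subseteq> frontier P" "connected W"
    and meet: "rel_interior F1 \<inter> W \<noteq> {}" "rel_interior F2 \<inter> W \<noteq> {}"
  shows "F1 = F2"
proof -
  have "aff_dim (affine hull F1) = 2" by (simp add: faceD(2)[OF F(1)])
  moreover have "openin (top_of_set (affine hull F1)) (rel_interior F1 \<union> W \<union> rel_interior F2)"
    using openin_rel_interior[of F1] openin_rel_interior[of F2] W(1) aff by (simp add: openin_Un)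
  moreover have "rel_interior F1 \<union> W \<union> rel_interior F2 \<subseteq> frontier P"
    using faceD(1)[OF F(1)] faceD(1)[OF F(2)] W(2) rel_interior_subset[of F1] rel_interior_subset[of F2]
    by blast
  moreover have "connected (rel_interior F1 \<union> W \<union> rel_interior F2)"
    using meet faceD(4)[OF F(1)] faceD(4)[OF F(2)] W(3) by (intro connected_Un) auto
  moreover have "rel_interior F1 \<union> W \<union> rel_interior F2 \<noteq> {}" using meet by auto
  ultimately obtain F where F': "F \<in> faces P" "rel_interior F1 \<union> W \<union> rel_interior F2 \<subseteq> rel_interior F"
    using face_exists[of "affine hull F1"] by (metis affine_affine_hull)
  have "F1 \<subseteq> F" "F2 \<subseteq> F"
    using F' faceD(5)[OF F(1)] faceD(5)[OF F(2)] faceD(5)[OF F'(1)]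
    by (metis closure_mono le_sup_iff)+
  then show ?thesis using F F'(1) unfolding faces_def by blast
qed

text \<open>Sending a face to a piece of boundary that it meets inside its own plane is injective by
  \<open>face_eqI\<close>. This serves for finiteness, with the cells of an arrangement, and for the
  face count of the rack, with explicit patches.\<close>

lemma faces_card_le:
  assumes fin: "finite I"
    and W: "\<And>p. p \<in> I \<Longrightarrow> openin (top_of_set (H p)) (W p) \<and> W p \<subseteq> frontier P \<and> connected (W p)"
    and hit: "\<And>F. F \<in> faces P \<Longrightarrow> \<exists>p\<in>I. affine hull F = H p \<and> rel_interior F \<inter> W p \<noteq> {}"
  shows "finite (faces P)" "card (faces P) \<le> card I"
proof -
  obtain g where g: "\<And>F. F \<in> faces P \<Longrightarrow> g F \<in> I \<and> affine hull F = H (g F) \<and> rel_interior F \<inter> W (g F) \<noteq> {}"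
    using hit by metis
  have inj: "inj_on g (faces P)"
  proof (rule inj_onI)
    fix F1 F2 assume "F1 \<in> faces P" "F2 \<in> faces P" "g F1 = g F2"
    then show "F1 = F2"
      using face_eqI[of F1 P F2 "W (g F1)"] g W by metis
  qed
  have sub: "g ` faces P \<subseteq> I" using g by auto
  show "finite (faces P)" using inj sub fin inj_on_finite by blast
  show "card (faces P) \<le> card I" using inj sub fin card_inj_on_le by blast
qed

section \<open>Faces in planes orthogonal to an axis\<close>

definition axis_plane :: "3 \<Rightarrow> real \<Rightarrow> (real^3) set" where
  "axis_plane i c = {x. x $ i = c}"

lemma axis_plane_hyperplane: "axis_plane i c = {x. axis i 1 \<bullet> x = c}"
  by (simp add: axis_plane_def inner_axis')

lemma axis_plane_basic [simp]:
  "affine (axis_plane i c)" "aff_dim (axis_plane i c) = 2" "closed (axis_plane i c)"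
    apply (simp add: axis_plane_hyperplane affine_hyperplane)
   apply (simp add: axis_plane_hyperplane aff_dim_hyperplane axis_eq_0_iff)
  apply (simp add: axis_plane_hyperplane closed_hyperplane)
  done

lemma face_affine_hull:
  assumes "F \<in> faces P" "F \<subseteq> axis_plane i c"
  shows "affine hull F = axis_plane i c"
proof -
  have "affine hull F \<subseteq> axis_plane i c" using assms(2) by (simp add: hull_minimal)
  then show ?thesis
    using faceD(2,3)[OF assms(1)] rel_interior_subset
    by (intro affine_dim_equal) auto
qed

lemma face_axis_unique:
  assumes "F \<in> faces P" "F \<subseteq> axis_plane i c" "F \<subseteq> axis_plane j d"
  shows "i = j" "c = d"
proof -
  have e: "axis_plane i c = axis_plane j d"
    using face_affine_hull assms by metis
  \<comment> \<open>All coordinates of this point except the \<open>i\<close>-th differ from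
    \<open>d\<close>, so its membership in the other plane forces \<open>j = i\<close>.\<close>
  have "(\<chi> k. if k = i then c else d + 1) \<in> axis_plane i c" by (simp add: axis_plane_def)
  then have "(\<chi> k. if k = i then c else d + 1) \<in> axis_plane j d" using e by simp
  then show "i = j" by (auto simp: axis_plane_def split: if_splits)
  then show "c = d" using e faceD(3)[OF assms(1)] rel_interior_subset assms unfolding axis_plane_def by blast
qed

section \<open>Flat boundary points and generic perturbations\<close>

text \<open>Each open half of the ball is connected and misses the boundary, so it lies inside or
  outside \<open>P\<close>. Regularity forbids both halves outside, and \<open>x\<close> being a
  boundary point forbids both inside; \<open>s\<close> is the sign for which \<open>s * a\<close>
  points outwards.\<close>

lemma flat_point:
  fixes P :: "'a::euclidean_space set"
  assumes reg: "closure (interior P) = P" and a: "a \<noteq> 0" and x: "x \<in> frontier P" "a \<bullet> x = b"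
    and e: "e > 0" and flat: "frontier P \<inter> ball x e \<subseteq> {y. a \<bullet> y = b}"
  obtains s where "s = 1 \<or> s = (-1::real)"
    "\<And>y. y \<in> ball x e \<Longrightarrow> s * (a \<bullet> y) < s * b \<Longrightarrow> y \<in> interior P"
    "\<And>y. y \<in> ball x e \<Longrightarrow> s * (a \<bullet> y) > s * b \<Longrightarrow> y \<notin> P"
    "\<And>y. y \<in> ball x e \<Longrightarrow> a \<bullet> y = b \<Longrightarrow> y \<in> frontier P"
proof -
  have clP: "closed P" using closed_closure[of "interior P"] unfolding reg .
  define L where "L = ball x e \<inter> {y. a \<bullet> y < b}"
  define R where "R = ball x e \<inter> {y. a \<bullet> y > b}"
  have cvx: "convex L" "convex R" unfolding L_def R_def
    by (auto intro!: convex_Int convex_halfspace_lt convex_halfspace_gt)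
  have opn: "open L" "open R" unfolding L_def R_def
    by (auto intro!: open_Int open_halfspace_lt open_halfspace_gt)
  have dich: "S \<subseteq> interior P \<or> S \<inter> P = {}" if "S = L \<or> S = R" for S
  proof -
    have nofr: "S \<inter> frontier P = {}" using flat that unfolding L_def R_def by auto
    have "connected S" using that cvx convex_connected by auto
    then have "S \<subseteq> P \<or> S \<inter> P = {}" using connected_Int_frontier[of S P] nofr by blast
    then show ?thesis using that opn interior_maximal by blast
  qed
  \<comment> \<open>Moving from \<open>y\<close> along \<open>a\<close> and against it enters the
    two halves, so the middle disc lies in both closures.\<close>
  have near: "y \<in> closure L \<and> y \<in> closure R" if y: "y \<in> ball x e" "a \<bullet> y = b" for y
  proof -
    have "\<exists>t>0. \<forall>u. \<bar>u\<bar> < t \<longrightarrow> y + u *\<^sub>R a \<in> ball x e"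
    proof -
      have "isCont (\<lambda>u. y + u *\<^sub>R a) 0" by (intro continuous_intros)
      then have "\<forall>\<^sub>F u in at 0. y + u *\<^sub>R a \<in> ball x e"
        using y(1) topological_tendstoD[of "\<lambda>u. y + u *\<^sub>R a" y "at 0" "ball x e"]
        by (simp add: isCont_def)
      then obtain t where "t > 0" "\<And>u. u \<noteq> 0 \<Longrightarrow> \<bar>u\<bar> < t \<Longrightarrow> y + u *\<^sub>R a \<in> ball x e"
        unfolding eventually_at by (auto simp: dist_real_def)
      then show ?thesis using y(1) by (metis add.right_neutral scaleR_zero_left)
    qed
    then obtain t where t: "t > 0" "\<And>u. \<bar>u\<bar> < t \<Longrightarrow> y + u *\<^sub>R a \<in> ball x e" by auto
    have lim: "((\<lambda>u. y + u *\<^sub>R a) \<longlongrightarrow> y) (at 0 within S)" for S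
    proof -
      have "((\<lambda>u. y + u *\<^sub>R a) \<longlongrightarrow> y + 0 *\<^sub>R a) (at 0 within S)" by (intro tendsto_intros)
      then show ?thesis by simp
    qed
    have aa: "a \<bullet> a > 0" using a by simp
    have "\<forall>\<^sub>F u in at_right 0. y + u *\<^sub>R a \<in> R"
      unfolding eventually_at_right[OF zero_less_one] using t y(2) aa
      by (intro exI[of _ t]) (auto simp: R_def inner_add_right)
    then have "y \<in> closure R"
      using Lim_in_closed_set[of "closure R" "\<lambda>u. y + u *\<^sub>R a" "at_right 0" y] lim closure_subset
      by (smt (verit, ccfv_SIG) closed_closure eventually_mono subsetD trivial_limit_at_right_real)
    moreover have "((\<lambda>u. y + (- u) *\<^sub>R a) \<longlongrightarrow> y + (- 0) *\<^sub>R a) (at_right 0)"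
      by (intro tendsto_intros)
    then have lim': "((\<lambda>u. y + (- u) *\<^sub>R a) \<longlongrightarrow> y) (at_right 0)" by simp
    have "y + (- u) *\<^sub>R a \<in> L" if "0 < u" "u < t" for u
      using t(2)[of "-u"] that y(2) aa by (auto simp: L_def inner_diff_right)
    then have "\<forall>\<^sub>F u in at_right 0. y + (- u) *\<^sub>R a \<in> L"
      unfolding eventually_at_right[OF zero_less_one] using t(1) by blast
    then have "y \<in> closure L"
      using Lim_in_closed_set[of "closure L" "\<lambda>u. y + (- u) *\<^sub>R a" "at_right 0" y] lim' closure_subset
      by (smt (verit, ccfv_SIG) closed_closure eventually_mono subsetD trivial_limit_at_right_real)
    ultimately show ?thesis by simp
  qed
  have nboth: "\<not> (L \<inter> P = {} \<and> R \<inter> P = {})"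
  proof
    assume "L \<inter> P = {} \<and> R \<inter> P = {}"
    \<comment> \<open>With both halves outside, this open set would lie in a hyperplane and hence be
      empty.\<close>
    then have "interior P \<inter> ball x e \<subseteq> {y. a \<bullet> y = b}"
      using interior_subset[of P] unfolding L_def R_def by force
    then have "interior P \<inter> ball x e = {}"
      using interior_maximal[of "interior P \<inter> ball x e" "{y. a \<bullet> y = b}"] interior_hyperplane[OF a]
      by (simp add: open_Int)
    then have "ball x e \<inter> closure (interior P) = {}"
      using open_Int_closure_eq_empty[of "ball x e" "interior P"] by (simp add: Int_commute)
    moreover have "x \<in> closure (interior P)" unfolding reg using x(1) frontier_subset_closed[OF clP] by (rule subsetD[rotated])
    moreover have "x \<in> ball x e" using e by simp
    ultimately show False by blast
  qed
  have nboth2: "\<not> (L \<subseteq> interior P \<and> R \<subseteq> interior P)"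
  proof
    assume lr: "L \<subseteq> interior P \<and> R \<subseteq> interior P"
    then have "closure L \<subseteq> P" using clP by (meson closure_minimal dual_order.trans interior_subset)
    have "ball x e \<subseteq> P"
    proof
      fix y assume y: "y \<in> ball x e"
      consider "y \<in> L" | "y \<in> R" | "a \<bullet> y = b" using y unfolding L_def R_def by fastforce
      then show "y \<in> P"
        using y lr near[OF y] \<open>closure L \<subseteq> P\<close> interior_subset[of P] by cases blast+
    qed
    then have "x \<in> interior P" using e by (meson centre_in_ball interior_maximal open_ball subsetD)
    then show False using x by (simp add: frontier_def)
  qed
  have fr: "y \<in> frontier P" if "y \<in> ball x e" "a \<bullet> y = b" for y
  proof -
    have c: "y \<in> closure L" "y \<in> closure R" using near[OF that] by blast+
    show ?thesis
    proof (cases "L \<inter> P = {}")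
      case True
      then have "R \<subseteq> P" using dich nboth interior_subset by blast
      then have "y \<in> closure P" "y \<in> closure (- P)"
        using c True closure_mono[of R P] closure_mono[of L "- P"] by auto
      then show ?thesis by (simp add: frontier_closures)
    next
      case False
      then have "L \<subseteq> interior P" using dich by blast
      then have "R \<inter> P = {}" "L \<subseteq> P" using dich nboth2 interior_subset by blast+
      then have "y \<in> closure P" "y \<in> closure (- P)"
        using c closure_mono[of L P] closure_mono[of R "- P"] by auto
      then show ?thesis by (simp add: frontier_closures)
    qed
  qed
  show ?thesis
  proof (cases "L \<inter> P = {}")
    case True
    then have "R \<subseteq> interior P" using dich nboth by blast
    moreover have "y \<in> R" if "y \<in> ball x e" "- 1 * (a \<bullet> y) < - 1 * b" for y
      using that unfolding R_def by auto
    moreover have "y \<in> L" if "y \<in> ball x e" "- 1 * (a \<bullet> y) > - 1 * b" for y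
      using that unfolding L_def by auto
    ultimately show ?thesis using True fr by (intro that[of "-1"]) blast+
  next
    case False
    then have "L \<subseteq> interior P" using dich by blast
    then have "R \<inter> P = {}" using dich nboth2 by blast
    moreover have "y \<in> L" if "y \<in> ball x e" "1 * (a \<bullet> y) < 1 * b" for y
      using that unfolding L_def by auto
    moreover have "y \<in> R" if "y \<in> ball x e" "1 * (a \<bullet> y) > 1 * b" for y
      using that unfolding R_def by auto
    ultimately show ?thesis using \<open>L \<subseteq> interior P\<close> fr by (intro that[of 1]) blast+
  qed
qed

text \<open>For \<open>s\<close> equal to 1 or -1 this says that the boundary near \<open>x\<close>
  is a disc orthogonal to axis \<open>i\<close>, with \<open>s\<close> the sign of the outer
  normal.\<close>

definition flat_at :: "(real^3) set \<Rightarrow> 3 \<Rightarrow> real \<Rightarrow> real^3 \<Rightarrow> real \<Rightarrow> bool" where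
  "flat_at P i s x e \<longleftrightarrow> e > 0 \<and> (\<forall>y\<in>ball x e.
     (s * (y $ i - x $ i) < 0 \<longrightarrow> y \<in> interior P) \<and>
     (s * (y $ i - x $ i) > 0 \<longrightarrow> y \<notin> P) \<and>
     (y $ i = x $ i \<longrightarrow> y \<in> frontier P))"

lemma flat_at_exists:
  assumes "closure (interior P) = P" "x \<in> frontier P" "e > 0"
    "frontier P \<inter> ball x e \<subseteq> axis_plane i (x $ i)"
  obtains s where "s = 1 \<or> s = -1" "flat_at P i s x e"
proof -
  have "axis i 1 \<noteq> (0::real^3)" by (simp add: axis_eq_0_iff)
  moreover have "axis i 1 \<bullet> x = x $ i" by (simp add: inner_axis')
  ultimately obtain s where s: "s = 1 \<or> s = (-1::real)"
    "\<And>y. y \<in> ball x e \<Longrightarrow> s * (axis i 1 \<bullet> y) < s * (x $ i) \<Longrightarrow> y \<in> interior P"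
    "\<And>y. y \<in> ball x e \<Longrightarrow> s * (axis i 1 \<bullet> y) > s * (x $ i) \<Longrightarrow> y \<notin> P"
    "\<And>y. y \<in> ball x e \<Longrightarrow> axis i 1 \<bullet> y = x $ i \<Longrightarrow> y \<in> frontier P"
    using flat_point[OF assms(1) _ assms(2) _ assms(3) assms(4)[unfolded axis_plane_hyperplane]]
    by blast
  have "flat_at P i s x e"
    unfolding flat_at_def using assms(3) s(2-4) by (auto simp: inner_axis' algebra_simps)
  then show ?thesis using that s(1) by blast
qed

text \<open>All coordinates in \<open>J\<close> are shifted by the same small \<open>t > 0\<close>;
  each pair of an index and an element of \<open>C\<close> excludes at most one value of
  \<open>t\<close>.\<close>

lemma generic_near:
  fixes x :: "real^3"
  assumes C: "finite C" and e: "e > 0"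
  obtains y where "y \<in> ball x e" "\<And>j. j \<in> J \<Longrightarrow> y $ j \<notin> C" "\<And>j. j \<notin> J \<Longrightarrow> y $ j = x $ j"
proof -
  define f where "f t = (\<chi> j. if j \<in> J then x $ j + t else x $ j)" for t
  have "((\<lambda>t. f t) \<longlongrightarrow> f 0) (at_right 0)"
    unfolding f_def by (intro vec_tendstoI) (auto intro!: tendsto_eq_intros)
  moreover have "f 0 = x" by (simp add: f_def vec_eq_iff)
  ultimately have "\<forall>\<^sub>F t in at_right 0. f t \<in> ball x e"
    using e topological_tendstoD[of f x "at_right 0" "ball x e"] by simp
  moreover have "\<forall>\<^sub>F t in at_right 0. \<forall>j\<in>UNIV. \<forall>c\<in>C. x $ j + t \<noteq> c"
  proof (intro eventually_ball_finite ballI)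
    fix j :: 3 and c assume "c \<in> C"
    show "\<forall>\<^sub>F t in at_right 0. x $ j + t \<noteq> c"
    proof (cases "c - x $ j > 0")
      case True
      then show ?thesis unfolding eventually_at_right[OF True] by (intro exI[of _ "c - x $ j"]) auto
    next
      case False
      then show ?thesis unfolding eventually_at_right[OF zero_less_one] by (intro exI[of _ 1]) auto
    qed
  qed (use C in auto)
  ultimately have "\<forall>\<^sub>F t in at_right 0. f t \<in> ball x e \<and> (\<forall>j. \<forall>c\<in>C. x $ j + t \<noteq> c)"
    by eventually_elim auto
  then obtain t :: real where "f t \<in> ball x e" "\<forall>j. \<forall>c\<in>C. x $ j + t \<noteq> c"
    using eventually_happens'[OF trivial_limit_at_right_real] by blast
  then show ?thesis by (intro that[of "f t"]) (auto simp: f_def)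
qed

section \<open>Covering the boundary by finitely many planes\<close>

lemma tetrahedron_regular:
  assumes "tetrahedron T"
  shows "compact T" "closure (interior T) = T"
    "\<exists>\<H>. finite \<H> \<and> (\<forall>(a,b)\<in>\<H>. a \<noteq> 0) \<and> frontier T \<subseteq> (\<Union>(a,b)\<in>\<H>. {x. a \<bullet> x = b})"
proof -
  obtain V where V: "finite V" "card V = 4" "\<not> affine_dependent V" "T = convex hull V"
    using assms unfolding tetrahedron_def by auto
  show comp: "compact T" using V by (simp add: finite_imp_compact_convex_hull)
  have "aff_dim T = 3" using V affine_independent_iff_card[of V] by (simp add: aff_dim_convex_hull)
  then have "affine hull T = UNIV" using aff_dim_eq_full[of T] by simp
  moreover have "T \<noteq> {}" using V by auto
  moreover have "convex T" using V by simp
  ultimately have "interior T \<noteq> {}" by (metis rel_interior_eq_empty rel_interior_interior)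
  then show "closure (interior T) = T"
    using convex_closure_interior[OF \<open>convex T\<close>] comp by (simp add: compact_imp_closed)
  have fr: "frontier T = \<Union> {convex hull (V - {v}) | v. v \<in> V}"
    using V frontier_of_convex_hull[of V] by simp
  have "\<exists>a b. a \<noteq> 0 \<and> convex hull (V - {v}) \<subseteq> {x. a \<bullet> x = b}" if "v \<in> V" for v
  proof -
    have "aff_dim (convex hull (V - {v})) < DIM(real^3)"
      using V that aff_dim_le_card[of "V - {v}"] by (simp add: aff_dim_convex_hull)
    then show ?thesis by (metis aff_lowdim_subset_hyperplane)
  qed
  then obtain a b where ab: "\<And>v. v \<in> V \<Longrightarrow> a v \<noteq> 0 \<and> convex hull (V - {v}) \<subseteq> {x. a v \<bullet> x = b v}"
    by metis
  show "\<exists>\<H>. finite \<H> \<and> (\<forall>(a,b)\<in>\<H>. a \<noteq> 0) \<and> frontier T \<subseteq> (\<Union>(a,b)\<in>\<H>. {x. a \<bullet> x = b})"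
  proof (intro exI conjI)
    show "finite ((\<lambda>v. (a v, b v)) ` V)" using V by simp
    show "frontier T \<subseteq> (\<Union>(a,b)\<in>(\<lambda>v. (a v, b v)) ` V. {x. a \<bullet> x = b})"
      unfolding fr using ab by fastforce
  qed (use ab in auto)
qed

text \<open>Finite unions preserve these properties: every tetrahedron lies in the closure of the
  interior of \<open>P\<close>, and the boundary of a union lies in the union of the
  boundaries.\<close>

lemma polyhedron_regular:
  assumes "polyhedron P"
  shows "compact P" "closure (interior P) = P"
    "\<exists>\<H>. finite \<H> \<and> (\<forall>(a,b)\<in>\<H>. a \<noteq> 0) \<and> frontier P \<subseteq> (\<Union>(a,b)\<in>\<H>. {x. a \<bullet> x = b})"
proof -
  obtain \<T> where T: "finite \<T>" "\<And>T. T \<in> \<T> \<Longrightarrow> tetrahedron T" "P = \<Union>\<T>"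
    using assms unfolding polyhedron_def by auto
  show comp: "compact P" using T tetrahedron_regular(1) by (simp add: compact_Union)
  have "T \<subseteq> closure (interior P)" if "T \<in> \<T>" for T
    using tetrahedron_regular(2)[OF T(2)[OF that]] closure_mono interior_mono T(3) that
    by (metis Union_upper)
  then have "P \<subseteq> closure (interior P)" using T(3) by auto
  moreover have "closure (interior P) \<subseteq> P"
    using comp by (simp add: closure_minimal compact_imp_closed interior_subset)
  ultimately show "closure (interior P) = P" by auto
  obtain h where h: "\<And>T. T \<in> \<T> \<Longrightarrow> finite (h T) \<and> (\<forall>(a,b)\<in>h T. a \<noteq> 0) \<and>
      frontier T \<subseteq> (\<Union>(a,b)\<in>h T. {x. a \<bullet> x = b})"
    using tetrahedron_regular(3) T(2) by metis
  show "\<exists>\<H>. finite \<H> \<and> (\<forall>(a,b)\<in>\<H>. a \<noteq> 0) \<and> frontier P \<subseteq> (\<Union>(a,b)\<in>\<H>. {x. a \<bullet> x = b})"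
  proof (intro exI conjI)
    show "finite (\<Union>T\<in>\<T>. h T)" using T h by auto
    show "frontier P \<subseteq> (\<Union>(a,b)\<in>(\<Union>T\<in>\<T>. h T). {x. a \<bullet> x = b})"
      using frontier_Union_subset[OF T(1)] h unfolding T(3) by fastforce
  qed (use h in fastforce)
qed

text \<open>In a minimal hyperplane arrangement covering the boundary, every hyperplane carries a face.\<close>

lemma orthogonal_axis_arrangement:
  assumes "orthogonal_polyhedron P"
  obtains C where "finite C" "\<And>x. x \<in> frontier P \<Longrightarrow> \<exists>i. x $ i \<in> C"
proof -
  have P: "polyhedron P" and ax: "\<And>F. F \<in> faces P \<Longrightarrow> \<exists>i c. F \<subseteq> axis_plane i c"
    using assms unfolding orthogonal_polyhedron_def axis_plane_def by auto
  define ok where "ok \<H> \<longleftrightarrow> finite \<H> \<and> (\<forall>(a,b)\<in>\<H>. a \<noteq> 0) \<and>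
      frontier P \<subseteq> (\<Union>(a,b)\<in>\<H>. {x. a \<bullet> x = b})" for \<H>
  obtain \<H> where H: "ok \<H>" and min: "\<And>\<G>. ok \<G> \<Longrightarrow> card \<H> \<le> card \<G>"
    using ex_has_least_nat[of ok _ card] polyhedron_regular(3)[OF P] unfolding ok_def by metis
  have fin: "finite \<H>" using H ok_def by auto
  have "\<exists>i c. {x. a \<bullet> x = b} \<subseteq> axis_plane i c" if ab: "(a, b) \<in> \<H>" for a b
  proof -
    \<comment> \<open>Minimality gives the hyperplane a boundary point \<open>x\<close> of its own,
      off the union \<open>D\<close> of the others; near \<open>x\<close> the boundary is
      flat.\<close>
    define D where "D = (\<Union>(a,b)\<in>\<H> - {(a,b)}. {x. a \<bullet> x = b})"
    have a0: "a \<noteq> 0" using H ab ok_def by auto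
    have "\<not> ok (\<H> - {(a,b)})"
      using min[of "\<H> - {(a,b)}"] card_Diff1_less[OF fin ab] by auto
    then have "\<not> frontier P \<subseteq> D" using H unfolding ok_def D_def by auto
    then obtain x where x: "x \<in> frontier P" "x \<notin> D" by auto
    have "closed D" unfolding D_def using fin by (auto simp: closed_hyperplane)
    then obtain e where e: "e > 0" "ball x e \<inter> D = {}"
      using x(2) by (metis ComplI disjoint_eq_subset_Compl inf_commute open_Compl open_contains_ball)
    have cover: "y \<in> D \<or> a \<bullet> y = b" if "y \<in> frontier P" for y
      using H that unfolding ok_def D_def by fastforce
    then have xb: "a \<bullet> x = b" and flat: "frontier P \<inter> ball x e \<subseteq> {y. a \<bullet> y = b}"
      using x e by auto
    let ?H = "{y. a \<bullet> y = b}"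
    let ?U = "?H \<inter> ball x e"
    have "?U \<subseteq> frontier P"
      using flat_point[OF polyhedron_regular(2)[OF P] a0 x(1) xb e(1) flat] by blast
    moreover have op: "openin (top_of_set ?H) ?U" by (simp add: openin_open_Int)
    moreover have ne: "?U \<noteq> {}" using xb e(1) by (metis (mono_tags, lifting) IntI centre_in_ball empty_iff mem_Collect_eq)
    moreover have "connected ?U" by (intro convex_connected convex_Int convex_hyperplane convex_ball)
    moreover have afH: "affine ?H" "aff_dim ?H = 2" using a0 by (auto simp: affine_hyperplane)
    ultimately obtain F where F: "F \<in> faces P" "?U \<subseteq> rel_interior F"
      using face_exists[of ?H ?U P] by metis
    obtain i c where ic: "F \<subseteq> axis_plane i c" using ax F by blast
    \<comment> \<open>The disc \<open>?U\<close> spans its hyperplane, and it lies in an axis plane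
      because the face containing it does.\<close>
    have "?H = affine hull ?H" using afH(1) by (metis affine_hull_eq)
    also have "\<dots> = affine hull ?U" using affine_hull_openin[of ?H ?U] op ne afH(1) by (simp add: hull_same)
    also have "\<dots> \<subseteq> axis_plane i c"
      using F(2) ic rel_interior_subset[of F] by (intro hull_minimal) auto
    finally show ?thesis by blast
  qed
  then obtain i c where ic: "\<And>a b. (a,b) \<in> \<H> \<Longrightarrow> {x. a \<bullet> x = b} \<subseteq> axis_plane (i a b) (c a b)"
    by metis
  show ?thesis
  proof (rule that[of "(\<lambda>(a,b). c a b) ` \<H>"])
    show "finite ((\<lambda>(a,b). c a b) ` \<H>)" using fin by auto
    fix x assume "x \<in> frontier P"
    then obtain a b where "(a,b) \<in> \<H>" "a \<bullet> x = b" using H unfolding ok_def by fastforce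
    then have "x $ i a b = c a b" using ic unfolding axis_plane_def by blast
    then show "\<exists>i. x $ i \<in> (\<lambda>(a,b). c a b) ` \<H>" using \<open>(a,b) \<in> \<H>\<close> by (metis case_prod_conv imageI)
  qed
qed

section \<open>Interior points of faces\<close>

text \<open>A chart maps the relatively open part \<open>S\<close> of the face injectively and
  continuously into the plane, so by invariance of domain the image is open. Pulled back by the
  chart, \<open>S\<close> is open in the whole boundary, which leaves no room for a second sheet
  through \<open>x\<close>.\<close>

lemma face_interior_locally_planar:
  assumes M: "two_manifold (frontier P)" and F: "F \<in> faces P" "F \<subseteq> axis_plane i c" and x: "x \<in> rel_interior F"
  obtains e where "e > 0" "frontier P \<inter> ball x e \<subseteq> axis_plane i c"
proof -
  have FP: "rel_interior F \<subseteq> frontier P" using faceD(1)[OF F(1)] rel_interior_subset by blast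
  then obtain U where U: "openin (top_of_set (frontier P)) U" "x \<in> U" "U homeomorphic (ball (0::real^2) 1)"
    using M x unfolding two_manifold_def by blast
  obtain h k where hk: "homeomorphism U (ball (0::real^2) 1) h k"
    using U(3) unfolding homeomorphic_def by auto
  obtain T where T: "open T" "U = frontier P \<inter> T" using U(1) by (auto simp: openin_open)
  define S where "S = rel_interior F \<inter> U"
  have "S = rel_interior F \<inter> T" using T(2) FP unfolding S_def by auto
  then have opS: "openin (top_of_set (axis_plane i c)) S"
    using openin_rel_interior[of F] T(1) by (metis face_affine_hull[OF F] openin_Int_open)
  have injh: "inj_on h U" using hk by (metis homeomorphism_apply1 inj_on_inverseI)
  have "openin (top_of_set (UNIV::(real^2) set)) (h ` S)"
  proof (rule invariance_of_domain_affine_sets[OF opS])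
    show "continuous_on S h" using hk unfolding S_def homeomorphism_def by (meson continuous_on_subset inf_le2)
    show "inj_on h S" using injh unfolding S_def by (meson inf_le2 inj_on_subset)
  qed auto
  then have "open (h ` S)" by simp
  moreover have "continuous_on U h" using hk unfolding homeomorphism_def by auto
  ultimately have "openin (top_of_set U) (U \<inter> h -` (h ` S))" by (simp add: continuous_openin_preimage_gen)
  moreover have "U \<inter> h -` (h ` S) = S" using injh unfolding S_def by (auto dest: inj_onD)
  ultimately have "openin (top_of_set (frontier P)) S" using U(1) openin_trans by metis
  then obtain T' where T': "open T'" "S = frontier P \<inter> T'" by (auto simp: openin_open)
  have "x \<in> T'" using x U(2) T' S_def by auto
  then obtain e where "e > 0" "ball x e \<subseteq> T'" using T'(1) open_contains_ball by blast
  moreover have "S \<subseteq> axis_plane i c" using F(2) rel_interior_subset unfolding S_def by blast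
  ultimately show ?thesis using that[of e] T'(2) by blast
qed

text \<open>The relative interior is open in its plane, so all coordinates but the fixed one can be
  perturbed away from \<open>C\<close>. Such points represent faces when faces are counted.\<close>

lemma face_generic_point:
  assumes finC: "finite C" and F: "F \<in> faces P" "F \<subseteq> axis_plane i c"
  obtains x where "x \<in> rel_interior F" "\<And>j. j \<noteq> i \<Longrightarrow> x $ j \<notin> C"
proof -
  obtain x where x: "x \<in> rel_interior F" using faceD(3)[OF F(1)] by auto
  obtain e where e: "e > 0" "ball x e \<inter> axis_plane i c \<subseteq> rel_interior F"
    using openin_rel_interior[of F] x unfolding face_affine_hull[OF F] openin_contains_ball by blast
  obtain y where y: "y \<in> ball x e" "\<And>j. j \<in> - {i} \<Longrightarrow> y $ j \<notin> C" "\<And>j. j \<notin> - {i} \<Longrightarrow> y $ j = x $ j"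
    using generic_near[OF finC e(1)] by metis
  have "x \<in> axis_plane i c" using x F(2) rel_interior_subset by blast
  then have "y \<in> axis_plane i c" using y(3)[of i] unfolding axis_plane_def by auto
  then show ?thesis using that y e by blast
qed

section \<open>Arrangements of axis-parallel planes\<close>

text \<open>One set \<open>C\<close> serves all three axes: the arrangement consists of the planes
  \<open>axis_plane j c\<close> for all \<open>j\<close> and all \<open>c\<close> in
  \<open>C\<close>.\<close>

locale axis_arranged =
  fixes P :: "(real^3) set" and C :: "real set"
  assumes regular: "closure (interior P) = P" and bounded: "bounded P" and finC: "finite C"
    and cover: "\<And>x. x \<in> frontier P \<Longrightarrow> \<exists>i. x $ i \<in> C"
begin

lemma closedP: "closed P"
  using closed_closure[of "interior P"] unfolding regular .

text \<open>Such a point lies on no plane of the arrangement except its own plane orthogonal to axis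
  \<open>i\<close>. The other planes, collected in \<open>D\<close>, stay at positive distance, so
  the boundary is flat at \<open>x\<close>.\<close>

lemma generic_flat:
  assumes x: "x \<in> frontier P" and gen: "\<And>j. j \<noteq> i \<Longrightarrow> x $ j \<notin> C"
  obtains s e where "s = 1 \<or> s = -1" "flat_at P i s x e"
proof -
  define D where "D = (\<Union>(j,c)\<in>UNIV \<times> C - {(i, x $ i)}. axis_plane j c)"
  have "closed D" unfolding D_def using finC by (intro closed_UN) auto
  moreover have "x \<notin> D" using gen unfolding D_def axis_plane_def by (auto, metis)
  ultimately obtain e where e: "e > 0" "ball x e \<inter> D = {}"
    by (metis ComplI disjoint_eq_subset_Compl open_Compl open_contains_ball)
  have "frontier P \<inter> ball x e \<subseteq> axis_plane i (x $ i)"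
  proof
    fix y assume y: "y \<in> frontier P \<inter> ball x e"
    then obtain k where "y $ k \<in> C" using cover by auto
    moreover have "y \<notin> D" using y e by auto
    ultimately have "(k, y $ k) = (i, x $ i)" unfolding D_def axis_plane_def by fastforce
    then show "y \<in> axis_plane i (x $ i)" unfolding axis_plane_def by auto
  qed
  then show ?thesis using flat_at_exists[OF regular x e(1)] that by metis
qed

text \<open>The boundary is flat wherever it meets the segment from \<open>x\<close> to
  \<open>y\<close>, so its trace on the segment is open; being closed as well, it is the whole
  segment. The positive products say that \<open>x\<close> and \<open>y\<close> lie strictly on the
  same side of each plane orthogonal to another axis.\<close>

lemma plane_cell:
  assumes x: "x \<in> frontier P" and xy: "x $ i = y $ i"
    and cell: "\<And>j c. j \<noteq> i \<Longrightarrow> c \<in> C \<Longrightarrow> (x $ j - c) * (y $ j - c) > 0"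
  shows "y \<in> frontier P"
proof -
  let ?S = "closed_segment x y"
  have zi: "z $ i = x $ i" if "z \<in> ?S" for z
    using that xy by (auto simp: in_segment) (simp add: algebra_simps)
  have gen: "z $ j \<notin> C" if z: "z \<in> ?S" and "j \<noteq> i" for z j
  proof
    assume c: "z $ j \<in> C"
    obtain u where u: "0 \<le> u" "u \<le> 1" "z = (1 - u) *\<^sub>R x + u *\<^sub>R y" using z by (auto simp: in_segment)
    let ?a = "x $ j - z $ j" and ?b = "y $ j - z $ j"
    have ab: "?a * ?b > 0" using cell[OF \<open>j \<noteq> i\<close> c] .
    have "z $ j = (1 - u) * x $ j + u * y $ j" using u(3) by simp
    then have "(1 - u) * ?a + u * ?b = 0" by (simp add: algebra_simps)
    \<comment> \<open>Multiplying by \<open>?a\<close> gives two nonnegative terms with sum zero;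
      \<open>?a * ?b > 0\<close> prevents both from vanishing.\<close>
    then have "(1 - u) * (?a * ?a) + u * (?a * ?b) = 0" by algebra
    moreover have "0 \<le> (1 - u) * (?a * ?a)" "0 \<le> u * (?a * ?b)" using u ab by auto
    ultimately have "(1 - u) * (?a * ?a) = 0" "u * (?a * ?b) = 0" by linarith+
    then show False using ab by auto
  qed
  have "openin (top_of_set ?S) (?S \<inter> frontier P)"
    unfolding openin_contains_ball
  proof (intro conjI ballI)
    fix z assume z: "z \<in> ?S \<inter> frontier P"
    then obtain s e where f: "flat_at P i s z e"
      using generic_flat[of z i] gen[of z] by (metis Int_iff)
    have "ball z e \<inter> ?S \<subseteq> frontier P"
    proof
      fix w assume w: "w \<in> ball z e \<inter> ?S"
      then have "w $ i = z $ i" using zi[of w] zi[of z] z by simp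
      then show "w \<in> frontier P" using f w unfolding flat_at_def by blast
    qed
    then show "\<exists>e>0. ball z e \<inter> ?S \<subseteq> ?S \<inter> frontier P" using f unfolding flat_at_def by auto
  qed auto
  moreover have "closedin (top_of_set ?S) (?S \<inter> frontier P)" by (simp add: closedin_closed_Int)
  ultimately have "?S \<inter> frontier P = {} \<or> ?S \<inter> frontier P = ?S"
    using connected_clopen[of ?S] by (metis connected_segment(1))
  then show ?thesis using x by auto
qed

text \<open>The planes orthogonal to the other axes cut a plane of the arrangement into cells, and
  by \<open>plane_cell\<close> a cell that meets the boundary lies in it. Each face is charged to
  the cell of one of its generic points.\<close>

lemma finite_faces:
  assumes ax: "\<And>F. F \<in> faces P \<Longrightarrow> \<exists>i c. F \<subseteq> axis_plane i c"
  shows "finite (faces P)"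
proof -
  \<comment> \<open>\<open>\<sigma>\<close> is the sign vector of the cell: it holds the pairs
    \<open>(j, c)\<close> whose plane lies above the cell.\<close>
  define cell where "cell i \<sigma> = {y::real^3. \<forall>(j,c)\<in>(-{i}) \<times> C. if (j,c) \<in> \<sigma> then y $ j < c else c < y $ j}"
    for i \<sigma>
  \<comment> \<open>Cells not contained in the boundary are replaced by the empty set, so that every
    index yields a subset of the boundary.\<close>
  define W where "W p = (case p of (i, c, \<sigma>) \<Rightarrow>
      (if axis_plane i c \<inter> cell i \<sigma> \<subseteq> frontier P then axis_plane i c \<inter> cell i \<sigma> else {}))" for p
  define H where "H p = (case p of (i, c, \<sigma>) \<Rightarrow> axis_plane i c)"
    for p :: "3 \<times> real \<times> (3 \<times> real) set"
  have cell_eq: "cell i \<sigma> = (\<Inter>(j,c)\<in>(-{i}) \<times> C. {y. if (j,c) \<in> \<sigma> then y $ j < c else c < y $ j})" for i \<sigma>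
    unfolding cell_def by auto
  have convex_lt: "convex {y::real^3. y $ j < c}" and convex_gt: "convex {y::real^3. c < y $ j}" for j c
    using convex_halfspace_lt[of "axis j 1 :: real^3" c] convex_halfspace_gt[of c "axis j 1 :: real^3"]
    unfolding inner_axis' by simp_all
  have half: "open {y::real^3. if (j,c) \<in> \<sigma> then y $ j < c else c < y $ j}"
    "convex {y::real^3. if (j,c) \<in> \<sigma> then y $ j < c else c < y $ j}" for j c \<sigma>
    using convex_lt[of j c] convex_gt[of c j] open_halfspace_component_lt_cart[of j c]
      open_halfspace_component_gt_cart[of c j]
    by (cases "(j,c) \<in> \<sigma>"; simp)+
  have opc: "open (cell i \<sigma>)" for i \<sigma>
    unfolding cell_eq case_prod_beta using finC by (intro open_INT ballI half(1)) auto
  have cvc: "convex (cell i \<sigma>)" for i \<sigma>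
    unfolding cell_eq case_prod_beta by (intro convex_INT half(2))
  have cellP: "axis_plane i c \<inter> cell i \<sigma> \<subseteq> frontier P"
    if "x \<in> frontier P" "x \<in> axis_plane i c" "x \<in> cell i \<sigma>" for i c \<sigma> x
  proof
    fix y assume y: "y \<in> axis_plane i c \<inter> cell i \<sigma>"
    show "y \<in> frontier P"
    proof (rule plane_cell[OF that(1)])
      show "x $ i = y $ i" using y that(2) by (simp add: axis_plane_def)
      show "0 < (x $ j - d) * (y $ j - d)" if "j \<noteq> i" "d \<in> C" for j d
      proof -
        have "if (j,d) \<in> \<sigma> then x $ j < d else d < x $ j" "if (j,d) \<in> \<sigma> then y $ j < d else d < y $ j"
          using y \<open>x \<in> cell i \<sigma>\<close> that unfolding cell_def by auto
        then show ?thesis by (auto simp: mult_neg_neg split: if_splits)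
      qed
    qed
  qed
  have I: "finite (UNIV \<times> C \<times> Pow (UNIV \<times> C) :: (3 \<times> real \<times> (3 \<times> real) set) set)"
    using finC by auto
  show "finite (faces P)"
  proof (rule faces_card_le(1)[OF I, where H = H and W = W])
    fix p :: "3 \<times> real \<times> (3 \<times> real) set"
    obtain i c \<sigma> where p: "p = (i, c, \<sigma>)" by (metis prod_cases3)
    have "convex (axis_plane i c)" by (simp add: affine_imp_convex)
    then show "openin (top_of_set (H p)) (W p) \<and> W p \<subseteq> frontier P \<and> connected (W p)"
      unfolding H_def W_def p using opc cvc
      by (auto simp: openin_open_Int intro!: convex_connected convex_Int)
  next
    fix F assume F: "F \<in> faces P"
    then obtain i c where ic: "F \<subseteq> axis_plane i c" using ax by blast
    obtain x where x: "x \<in> rel_interior F" "\<And>j. j \<noteq> i \<Longrightarrow> x $ j \<notin> C"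
      using face_generic_point[OF finC F ic] by blast
    have xF: "x \<in> frontier P" "x \<in> axis_plane i c"
      using x(1) faceD(1)[OF F] ic rel_interior_subset by blast+
    then obtain k where "x $ k \<in> C" using cover by blast
    then have "c \<in> C" using x(2) xF(2) unfolding axis_plane_def by (metis mem_Collect_eq)
    define \<sigma> where "\<sigma> = {(j, d). d \<in> C \<and> x $ j < d}"
    have "d < x $ j" if "j \<noteq> i" "d \<in> C" "\<not> x $ j < d" for j d
      using x(2)[OF that(1)] that(2,3) by (metis linorder_neqE)
    then have "x \<in> cell i \<sigma>" unfolding cell_def \<sigma>_def by auto
    then have "x \<in> W (i, c, \<sigma>)" using cellP[OF xF] xF unfolding W_def by auto
    moreover have "(i, c, \<sigma>) \<in> UNIV \<times> C \<times> Pow (UNIV \<times> C)" using \<open>c \<in> C\<close> unfolding \<sigma>_def by auto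
    moreover have "affine hull F = H (i, c, \<sigma>)" unfolding H_def using face_affine_hull[OF F ic] by simp
    ultimately show "\<exists>p\<in>UNIV \<times> C \<times> Pow (UNIV \<times> C). affine hull F = H p \<and> rel_interior F \<inter> W p \<noteq> {}"
      using x(1) by blast
  qed
qed

end

section \<open>The six classes of faces by outer normal\<close>

text \<open>A single flat point suffices, since that is what a ray provides; that it determines
  \<open>i\<close> and \<open>s\<close> for the whole face is the content of
  \<open>side_faces_disjoint\<close>.\<close>

definition side_faces :: "(real^3) set \<Rightarrow> 3 \<Rightarrow> real \<Rightarrow> (real^3) set set" where
  "side_faces P i s = {F \<in> faces P. (\<exists>c. F \<subseteq> axis_plane i c) \<and> (\<exists>x\<in>rel_interior F. \<exists>e. flat_at P i s x e)}"

text \<open>Just beyond \<open>x\<close> along axis \<open>i\<close>, one hypothesis gives the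
  outside and the other the interior.\<close>

lemma flat_at_sides:
  assumes "flat_at P i 1 x e" "flat_at P i (-1) x e'"
  shows False
proof -
  define t where "t = min e e' / 2"
  have t: "t > 0" "t < e" "t < e'" using assms unfolding flat_at_def t_def by auto
  define y where "y = x + t *\<^sub>R axis i 1"
  have "dist x y = t" using t by (simp add: y_def dist_norm norm_axis_1)
  moreover have "y $ i - x $ i = t" by (simp add: y_def axis_def)
  ultimately have "y \<notin> P" "y \<in> interior P"
    using assms t unfolding flat_at_def by auto
  then show False using interior_subset by blast
qed

text \<open>Since the boundary is a manifold, it stays planar along the relative interior of a face, so the
  outer side cannot switch there.\<close>

lemma side_faces_disjoint:
  assumes reg: "closure (interior P) = P" and M: "two_manifold (frontier P)"
    and F: "F \<in> side_faces P i s" "F \<in> side_faces P i' s'"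
    and s: "s = 1 \<or> s = -1" "s' = 1 \<or> s' = -1"
  shows "i = i'" "s = s'"
proof -
  obtain c where c: "F \<in> faces P" "F \<subseteq> axis_plane i c" using F unfolding side_faces_def by auto
  show ii: "i = i'" using face_axis_unique c F unfolding side_faces_def by blast
  \<comment> \<open>The points of outer sign \<open>s\<close>. For the two signs these sets are
    relatively open, disjoint, and cover the connected relative interior, so one of them is
    empty.\<close>
  define A where "A s = {x \<in> rel_interior F. \<exists>e. flat_at P i s x e}" for s
  have xi: "x $ i = c" if "x \<in> rel_interior F" for x
    using that c(2) rel_interior_subset unfolding axis_plane_def by blast
  have op: "openin (top_of_set (rel_interior F)) (A s)" for s
    unfolding openin_contains_ball
  proof (intro conjI ballI)
    fix x assume x: "x \<in> A s"
    then obtain e where e: "flat_at P i s x e" and xF: "x \<in> rel_interior F" unfolding A_def by auto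
    have "flat_at P i s y (e/2)" if y: "y \<in> ball x (e/2)" "y \<in> rel_interior F" for y
    proof -
      have "z \<in> ball x e" if "z \<in> ball y (e/2)" for z
        using that y(1) dist_triangle[of x z y] by (auto simp: dist_commute)
      moreover have "y $ i = x $ i" using xi y xF by auto
      ultimately show ?thesis using e unfolding flat_at_def by auto
    qed
    then have "ball x (e/2) \<inter> rel_interior F \<subseteq> A s" unfolding A_def by blast
    moreover have "e/2 > 0" using e unfolding flat_at_def by auto
    ultimately show "\<exists>e>0. ball x e \<inter> rel_interior F \<subseteq> A s" by blast
  qed (auto simp: A_def)
  have cov: "rel_interior F \<subseteq> A 1 \<union> A (-1)"
  proof
    fix x assume x: "x \<in> rel_interior F"
    obtain e where e: "e > 0" "frontier P \<inter> ball x e \<subseteq> axis_plane i (x $ i)"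
      using face_interior_locally_planar[OF M c x] xi[OF x] by metis
    have "x \<in> frontier P" using x faceD(1)[OF c(1)] rel_interior_subset by blast
    then obtain s where "s = 1 \<or> s = -1" "flat_at P i s x e"
      using flat_at_exists[OF reg _ e] by blast
    then show "x \<in> A 1 \<union> A (-1)" using x unfolding A_def by auto
  qed
  have dis: "A 1 \<inter> A (-1) = {}" using flat_at_sides unfolding A_def by blast
  have "A 1 = {} \<or> A (-1) = {}"
    using faceD(4)[OF c(1)] op cov dis unfolding connected_openin by metis
  moreover have "A s \<noteq> {}" "A s' \<noteq> {}"
    using F ii unfolding side_faces_def A_def by auto
  ultimately show "s = s'" using s by auto
qed

context axis_arranged
begin

text \<open>Shoot a generic ray from near \<open>p\<close> in direction \<open>s\<close> along axis \<open>i\<close>. The cells it crosses before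
  its first boundary hit \<open>y\<close> form a box in \<open>P\<close> whose closure contains both \<open>p\<close> and \<open>y\<close>.\<close>

lemma side_faces_guard:
  assumes p: "p \<in> P" and s: "s = 1 \<or> s = -1"
    and ax: "\<And>F. F \<in> faces P \<Longrightarrow> \<exists>i c. F \<subseteq> axis_plane i c"
  obtains F y where "F \<in> side_faces P i s" "y \<in> rel_interior F" "closed_segment p y \<subseteq> P"
proof -
  have ss: "s * s = 1" using s by auto
  \<comment> \<open>\<open>D\<close> collects the planes that miss \<open>p\<close>. None of them is
    crossed inside \<open>ball p d\<close>, so a generic \<open>r\<close> there is separated from
    \<open>p\<close> by no plane, although \<open>p\<close> may lie on some.\<close>
  define D where "D = (\<Union>(j,c)\<in>{(j,c). c \<in> C \<and> p $ j \<noteq> c}. axis_plane j c)"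
  have "finite {(j::3,c). c \<in> C \<and> p $ j \<noteq> c}"
    by (rule finite_subset[of _ "UNIV \<times> C"]) (use finC in auto)
  then have "closed D" unfolding D_def by (intro closed_UN) auto
  moreover have "p \<notin> D" unfolding D_def axis_plane_def by auto
  ultimately obtain d where d: "d > 0" "ball p d \<inter> D = {}"
    by (metis ComplI disjoint_eq_subset_Compl open_Compl open_contains_ball)
  have "p \<in> closure (interior P)" using p unfolding regular .
  moreover have "p \<in> ball p d" using d(1) by simp
  ultimately have "interior P \<inter> ball p d \<noteq> {}"
    using open_Int_closure_eq_empty[of "ball p d" "interior P"] by (metis disjoint_iff open_ball)
  then obtain r0 where r0: "r0 \<in> interior P \<inter> ball p d" by blast
  obtain e0 where e0: "e0 > 0" "ball r0 e0 \<subseteq> interior P \<inter> ball p d"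
    using r0 by (metis open_Int open_ball open_contains_ball open_interior)
  obtain r where r: "r \<in> ball r0 e0" and gen: "\<And>j. r $ j \<notin> C"
    using generic_near[OF finC e0(1), of r0 UNIV] by auto
  have rP: "r \<in> interior P" and rd: "r \<in> ball p d" using r e0 by auto
  have sideP: "(r $ j - c) * (p $ j - c) \<ge> 0" if "c \<in> C" for j c
  proof (rule ccontr)
    assume neg: "\<not> (r $ j - c) * (p $ j - c) \<ge> 0"
    then have ne: "p $ j \<noteq> c" by auto
    \<comment> \<open>The parameter at which the segment from \<open>p\<close> to \<open>r\<close>
      would cross the plane \<open>c\<close>.\<close>
    define u where "u = (p $ j - c) / (p $ j - r $ j)"
    have u: "0 \<le> u" "u \<le> 1" "p $ j \<noteq> r $ j"
    proof -
      have "r $ j < c \<and> c < p $ j \<or> p $ j < c \<and> c < r $ j"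
        using neg by (auto simp: zero_le_mult_iff not_le not_less)
      then show "0 \<le> u" "u \<le> 1" "p $ j \<noteq> r $ j" unfolding u_def by (auto simp: divide_simps)
    qed
    define z where "z = (1 - u) *\<^sub>R p + u *\<^sub>R r"
    have "z \<in> ball p d"
      using convexD[OF convex_ball, of p p d r "1 - u" u] u d(1) rd unfolding z_def by auto
    moreover have "z $ j = c"
    proof -
      have "z $ j = p $ j - u * (p $ j - r $ j)" unfolding z_def by (simp add: algebra_simps)
      also have "\<dots> = c" unfolding u_def using u(3) by simp
      finally show ?thesis .
    qed
    ultimately show False using d(2) ne that unfolding D_def axis_plane_def by blast
  qed
  define ray where "ray t = r + (t * s) *\<^sub>R axis i 1" for t
  have ray_i: "ray t $ i = r $ i + t * s" for t by (simp add: ray_def axis_def)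
  have ray_j: "ray t $ j = r $ j" if "j \<noteq> i" for t j using that by (simp add: ray_def axis_def)
  have cont: "continuous_on UNIV ray" unfolding ray_def by (intro continuous_intros)
  have dist_ray: "dist (ray t) (ray t') = \<bar>t - t'\<bar>" for t t'
  proof -
    have "ray t - ray t' = ((t - t') * s) *\<^sub>R axis i 1" unfolding ray_def by (simp add: algebra_simps)
    then show ?thesis using s by (auto simp: dist_norm norm_axis_1 abs_mult)
  qed
  define T where "T = {t. 0 \<le> t \<and> ray t \<in> frontier P}"
  have clT: "closed T"
  proof -
    have "T = {0..} \<inter> ray -` frontier P" unfolding T_def by auto
    moreover have "closed (ray -` frontier P)"
      using cont by (simp add: closed_vimage)
    ultimately show ?thesis by auto
  qed
  have inP: "ray t \<in> interior P" if "0 \<le> t" "\<And>t'. 0 \<le> t' \<Longrightarrow> t' \<le> t \<Longrightarrow> t' \<notin> T" for t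
  proof -
    have "connected (ray ` {0..t})"
      using cont by (intro connected_continuous_image) (auto intro: continuous_on_subset)
    moreover have "ray ` {0..t} \<inter> frontier P = {}" using that unfolding T_def by auto
    moreover have "ray 0 \<in> ray ` {0..t} \<inter> P" using that(1) rP interior_subset unfolding ray_def by auto
    ultimately have "ray ` {0..t} \<subseteq> P" using connected_Int_frontier[of "ray ` {0..t}" P] by blast
    moreover have "ray t \<in> ray ` {0..t}" using that(1) by auto
    ultimately have "ray t \<in> P" "ray t \<notin> frontier P" using \<open>ray ` {0..t} \<inter> frontier P = {}\<close> by blast+
    then show ?thesis unfolding frontier_def using closure_subset by blast
  qed
  have "T \<noteq> {}"
  proof
    assume "T = {}"
    then have all: "ray t \<in> P" if "t \<ge> 0" for t using inP[OF that] interior_subset by auto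
    obtain B where B: "\<And>x. x \<in> P \<Longrightarrow> dist (ray 0) x \<le> B" using bounded bounded_any_center[of P "ray 0"] by blast
    show False using B[OF all[of "\<bar>B\<bar> + 1"]] dist_ray[of 0 "\<bar>B\<bar> + 1"] by auto
  qed
  define t0 where "t0 = Inf T"
  have bb: "bdd_below T" unfolding T_def by (intro bdd_belowI[of _ 0]) auto
  have t0T: "t0 \<in> T" unfolding t0_def by (rule closed_contains_Inf[OF \<open>T \<noteq> {}\<close> bb clT])
  have t0min: "t \<notin> T" if "t < t0" for t
    using cInf_lower[OF _ bb, of t] that unfolding t0_def by auto
  have "t0 \<noteq> 0"
    using t0T rP unfolding T_def ray_def frontier_def by auto
  then have t0pos: "t0 > 0" using t0T unfolding T_def by auto
  define y where "y = ray t0"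
  have yf: "y \<in> frontier P" using t0T unfolding T_def y_def by auto
  have ygen: "y $ j \<notin> C" if "j \<noteq> i" for j using gen ray_j[OF that] unfolding y_def by simp
  then have yiC: "y $ i \<in> C" using cover[OF yf] by metis
  obtain s' e where s': "s' = 1 \<or> s' = -1" and fl: "flat_at P i s' y e"
    using generic_flat[OF yf] ygen by metis
  have e: "e > 0" using fl unfolding flat_at_def by auto
  have "s' = s"
  proof (rule ccontr)
    assume "s' \<noteq> s"
    then have s's: "s' = - s" using s s' by auto
    \<comment> \<open>A time just before the hit, nonnegative and within \<open>e\<close> of
      \<open>t0\<close>, so that the ray is still in the interior. With the opposite sign this point
      would be outside.\<close>
    define t where "t = t0 - min e t0 / 2"
    have t: "0 \<le> t" "t < t0" "t0 - t < e" using e t0pos unfolding t_def by auto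
    have "ray t \<in> interior P" using inP t t0min by auto
    moreover have "ray t \<in> ball y e" using t dist_ray[of t0 t] unfolding y_def by auto
    moreover have "s' * (ray t $ i - y $ i) = t0 - t"
    proof -
      have "s' * (ray t $ i - y $ i) = (s * s) * (t0 - t)"
        unfolding s's y_def ray_i by (simp add: algebra_simps)
      then show ?thesis using ss by simp
    qed
    ultimately show False using fl t interior_subset[of P] unfolding flat_at_def by auto
  qed
  have "axis_plane i (y $ i) \<inter> ball y e \<subseteq> frontier P"
    using fl unfolding flat_at_def axis_plane_def by auto
  moreover have "connected (axis_plane i (y $ i) \<inter> ball y e)"
    by (intro convex_connected convex_Int) (auto simp: affine_imp_convex)
  moreover have "y \<in> axis_plane i (y $ i) \<inter> ball y e" using e by (simp add: axis_plane_def)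
  ultimately obtain F where F: "F \<in> faces P" "axis_plane i (y $ i) \<inter> ball y e \<subseteq> rel_interior F"
     "F \<subseteq> axis_plane i (y $ i)"
    using face_exists[of "axis_plane i (y $ i)" "axis_plane i (y $ i) \<inter> ball y e" P]
    by (metis axis_plane_basic(1,2) empty_iff open_ball openin_open_Int)
  have yF: "y \<in> rel_interior F" using F(2) \<open>y \<in> axis_plane i (y $ i) \<inter> ball y e\<close> by blast
  have FS: "F \<in> side_faces P i s"
    unfolding side_faces_def using F yF fl \<open>s' = s\<close> by blast
  \<comment> \<open>The walls of the box: all planes orthogonal to the other axes, those orthogonal
    to axis \<open>i\<close> behind \<open>r\<close>, and the plane of \<open>y\<close>. Planes
    between \<open>r\<close> and \<open>y\<close> are left out, because the ray crosses them without
    meeting the boundary.\<close>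
  define Q where "Q = {(j,c). c \<in> C \<and> (j \<noteq> i \<or> s * c < s * r $ i \<or> c = y $ i)}"
  define K where "K = {w. \<forall>(j,c)\<in>Q. (r $ j - c) * (w $ j - c) > 0}"
  define K' where "K' = {w. \<forall>(j,c)\<in>Q. (r $ j - c) * (w $ j - c) \<ge> 0}"
  have rs: "(r $ j - c) * (r $ j - c) > 0" if "c \<in> C" for j c
    using gen[of j] that by (metis mult_pos_pos mult_neg_neg linorder_neqE eq_iff_diff_eq_0)
  have rK: "r \<in> K" unfolding K_def Q_def using rs by auto
  \<comment> \<open>Any positive step from the closed box \<open>K'\<close> towards a point of the
    open box \<open>K\<close> lands in \<open>K\<close>; hence \<open>K'\<close> lies in the closure
    of \<open>K\<close>.\<close>
  have comb: "(1 - u) *\<^sub>R w + u *\<^sub>R v \<in> K" if "w \<in> K'" "v \<in> K" "0 < u" "u \<le> 1" for w v u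
  proof -
    have "(r $ j - c) * (((1 - u) *\<^sub>R w + u *\<^sub>R v) $ j - c) > 0" if "(j,c) \<in> Q" for j c
    proof -
      have "(r $ j - c) * (((1 - u) *\<^sub>R w + u *\<^sub>R v) $ j - c)
          = (1 - u) * ((r $ j - c) * (w $ j - c)) + u * ((r $ j - c) * (v $ j - c))"
        by (simp add: algebra_simps)
      moreover have "(1 - u) * ((r $ j - c) * (w $ j - c)) \<ge> 0"
        using \<open>w \<in> K'\<close> \<open>u \<le> 1\<close> that unfolding K'_def by auto
      moreover have "u * ((r $ j - c) * (v $ j - c)) > 0"
        using \<open>v \<in> K\<close> \<open>0 < u\<close> that unfolding K_def by auto
      ultimately show ?thesis by linarith
    qed
    then show ?thesis unfolding K_def by auto
  qed
  have KK': "K \<subseteq> K'" unfolding K_def K'_def by (auto simp: less_imp_le)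
  have "convex K"
    unfolding convex_alt
  proof (intro ballI allI impI)
    fix w v u assume *: "w \<in> K" "v \<in> K" "(0::real) \<le> u \<and> u \<le> 1"
    show "(1 - u) *\<^sub>R w + u *\<^sub>R v \<in> K"
      by (cases "u = 0") (use * comb KK' in auto)
  qed
  have "K \<inter> frontier P = {}"
  proof (rule ccontr)
    assume "K \<inter> frontier P \<noteq> {}"
    then obtain w where w: "w \<in> K" "w \<in> frontier P" by auto
    then have wQ: "(r $ j - c) * (w $ j - c) > 0" if "(j,c) \<in> Q" for j c using that unfolding K_def by auto
    have "w $ j \<notin> C" if "j \<noteq> i" for j using wQ[of j "w $ j"] that unfolding Q_def by auto
    then have wC: "w $ i \<in> C" using cover[OF w(2)] by metis
    then have "(i, w $ i) \<notin> Q" using wQ[of i "w $ i"] by auto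
    then have ge: "s * w $ i \<ge> s * r $ i" using wC unfolding Q_def by auto
    define t where "t = s * (w $ i - r $ i)"
    have "t \<ge> 0" using ge unfolding t_def by (simp add: algebra_simps)
    have wt: "w $ i = r $ i + t * s" using s unfolding t_def by auto
    have "(r $ i - y $ i) * (w $ i - y $ i) > 0" using wQ[of i "y $ i"] yiC unfolding Q_def by auto
    moreover have "(r $ i - y $ i) * (w $ i - y $ i) = (s * s) * (t0 * (t0 - t))"
      unfolding y_def ray_i wt by (simp add: algebra_simps)
    ultimately have "t0 * (t0 - t) > 0" using ss by simp
    then have "t < t0" using t0pos by (simp add: zero_less_mult_iff)
    \<comment> \<open>Transported within its plane to the ray, a boundary point \<open>w\<close> of
      the open box would be a hit before \<open>t0\<close>.\<close>
    have "ray t \<in> frontier P"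
    proof (rule plane_cell[OF w(2)])
      show "w $ i = ray t $ i" using wt ray_i by simp
      show "0 < (w $ j - c) * (ray t $ j - c)" if "j \<noteq> i" "c \<in> C" for j c
        using wQ[of j c] that ray_j unfolding Q_def by (simp add: mult.commute)
    qed
    then have "t \<in> T" using \<open>t \<ge> 0\<close> unfolding T_def by auto
    then show False using t0min \<open>t < t0\<close> by auto
  qed
  then have "K \<subseteq> P"
    using connected_Int_frontier[of K P] convex_connected[OF \<open>convex K\<close>] rK rP interior_subset by blast
  then have "closure K \<subseteq> P" by (rule closure_minimal[OF _ closedP])
  have "w \<in> closure K" if w: "w \<in> K'" for w
  proof -
    have "((\<lambda>u. (1 - u) *\<^sub>R w + u *\<^sub>R r) \<longlongrightarrow> (1 - 0) *\<^sub>R w + 0 *\<^sub>R r) (at_right 0)"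
      by (intro tendsto_intros)
    then have lim: "((\<lambda>u. (1 - u) *\<^sub>R w + u *\<^sub>R r) \<longlongrightarrow> w) (at_right 0)" by simp
    have "(1 - u) *\<^sub>R w + u *\<^sub>R r \<in> closure K" if "0 < u" "u < 1" for u
      using comb[OF w rK, of u] that closure_subset[of K] by auto
    then have "\<forall>\<^sub>F u in at_right 0. (1 - u) *\<^sub>R w + u *\<^sub>R r \<in> closure K"
      unfolding eventually_at_right[OF zero_less_one] using zero_less_one by blast
    then show ?thesis
      using Lim_in_closed_set[OF closed_closure _ trivial_limit_at_right_real lim] by blast
  qed
  then have "K' \<subseteq> P" using \<open>closure K \<subseteq> P\<close> by blast
  have "p \<in> K'" unfolding K'_def Q_def using sideP by auto
  have "y \<in> K'"
    unfolding K'_def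
  proof clarify
    fix j c assume "(j, c) \<in> Q"
    then consider "j \<noteq> i" "c \<in> C" | "j = i" "s * c < s * r $ i" | "j = i" "c = y $ i" unfolding Q_def by auto
    then show "0 \<le> (r $ j - c) * (y $ j - c)"
    proof cases
      case 1
      then show ?thesis using ray_j[of j t0] unfolding y_def by simp
    next
      case 2
      \<comment> \<open>Substituting \<open>y $ i = r $ i + t0 * s\<close> gives two nonnegative
        terms, because \<open>r\<close> lies ahead of the plane \<open>c\<close>.\<close>
      have "(r $ i - c) * (y $ i - c) = (s * (r $ i - c)) * (s * (r $ i - c)) * (s * s) + t0 * (s * (r $ i - c))"
        using s unfolding y_def ray_i by (auto simp: algebra_simps)
      moreover have "s * (r $ i - c) > 0" using 2 by (simp add: algebra_simps)
      ultimately show ?thesis using 2 ss t0pos by simp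
    qed auto
  qed
  have "convex K'"
    unfolding convex_alt
  proof (intro ballI allI impI)
    fix w v u assume *: "w \<in> K'" "v \<in> K'" "(0::real) \<le> u \<and> u \<le> 1"
    have "(r $ j - c) * (((1 - u) *\<^sub>R w + u *\<^sub>R v) $ j - c) \<ge> 0" if "(j,c) \<in> Q" for j c
    proof -
      have "(r $ j - c) * (((1 - u) *\<^sub>R w + u *\<^sub>R v) $ j - c)
          = (1 - u) * ((r $ j - c) * (w $ j - c)) + u * ((r $ j - c) * (v $ j - c))"
        by (simp add: algebra_simps)
      moreover have "(1 - u) * ((r $ j - c) * (w $ j - c)) \<ge> 0" "u * ((r $ j - c) * (v $ j - c)) \<ge> 0"
        using * that unfolding K'_def by auto
      ultimately show ?thesis by linarith
    qed
    then show "(1 - u) *\<^sub>R w + u *\<^sub>R v \<in> K'" unfolding K'_def by auto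
  qed
  then have "closed_segment p y \<subseteq> P"
    using \<open>p \<in> K'\<close> \<open>y \<in> K'\<close> \<open>K' \<subseteq> P\<close> closed_segment_subset by blast
  then show ?thesis using that FS yF by blast
qed

end

section \<open>The upper bound\<close>

theorem orthogonal_polyhedron_guarded:
  assumes P: "orthogonal_polyhedron P"
  obtains G where "finite G" "card G \<le> card (faces P) div 6" "guarded_by_open_faces P G"
proof -
  have poly: "polyhedron P" and ax: "\<And>F. F \<in> faces P \<Longrightarrow> \<exists>i c. F \<subseteq> axis_plane i c"
    using P unfolding orthogonal_polyhedron_def axis_plane_def by auto
  have M: "two_manifold (frontier P)" using poly unfolding polyhedron_def by auto
  note reg = polyhedron_regular(2)[OF poly]
  obtain C where C: "finite C" "\<And>x. x \<in> frontier P \<Longrightarrow> \<exists>i. x $ i \<in> C"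
    using orthogonal_axis_arrangement[OF P] by blast
  interpret axis_arranged P C
    using C reg polyhedron_regular(1)[OF poly] by unfold_locales (auto simp: compact_imp_bounded)
  have fin: "finite (faces P)" using finite_faces ax by blast
  define I where "I = (UNIV::3 set) \<times> {1, -1::real}"
  have cardI: "card I = 6" "finite I" unfolding I_def by (auto simp: card_cartesian_product)
  define S where "S p = side_faces P (fst p) (snd p)" for p
  have sub: "S p \<subseteq> faces P" for p unfolding S_def side_faces_def by auto
  have "(\<Sum>p\<in>I. card (S p)) = card (\<Union>p\<in>I. S p)"
  proof (rule card_UN_disjoint[symmetric])
    show "\<forall>p\<in>I. finite (S p)" using sub fin finite_subset by blast
    have "p = q" if "p \<in> I" "q \<in> I" "F \<in> S p" "F \<in> S q" for p q F
      using side_faces_disjoint[OF reg M, of F "fst p" "snd p" "fst q" "snd q"] that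
      unfolding S_def I_def by (auto simp: prod_eq_iff)
    then show "\<forall>p\<in>I. \<forall>q\<in>I. p \<noteq> q \<longrightarrow> S p \<inter> S q = {}" by blast
  qed (use cardI in auto)
  also have "\<dots> \<le> card (faces P)" using sub fin by (intro card_mono) auto
  finally have sum: "(\<Sum>p\<in>I. card (S p)) \<le> card (faces P)" .
  have "\<exists>p\<in>I. 6 * card (S p) \<le> card (faces P)"
  proof (rule ccontr)
    assume "\<not> (\<exists>p\<in>I. 6 * card (S p) \<le> card (faces P))"
    then have "\<And>p. p \<in> I \<Longrightarrow> card (faces P) < 6 * card (S p)" by auto
    then have "(\<Sum>p\<in>I. card (faces P)) < (\<Sum>p\<in>I. 6 * card (S p))"
      using cardI by (intro sum_strict_mono) auto
    then show False using sum cardI by (simp flip: sum_distrib_left)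
  qed
  then obtain p where p: "p \<in> I" "6 * card (S p) \<le> card (faces P)" by auto
  show ?thesis
  proof (rule that[of "S p"])
    show "finite (S p)" using sub fin finite_subset by blast
    show "card (S p) \<le> card (faces P) div 6" using p(2) by auto
    have "snd p = 1 \<or> snd p = -1" using p(1) unfolding I_def by auto
    then show "guarded_by_open_faces P (S p)"
      unfolding guarded_by_open_faces_def guards_def visible_def
      using sub side_faces_guard[OF _ _ ax] unfolding S_def by (metis UN_I)
  qed
qed

section \<open>Manifold boundaries of unions of boxes\<close>

text \<open>The boundary of a compact starlike body is a sphere, and a sphere without one point is a
  plane. Pulling back a small disc around the image of \<open>x\<close> gives a disc that fits into
  \<open>N\<close>.\<close>

lemma starlike_frontier_disc:
  fixes S :: "(real^3) set"
  assumes S: "compact S" and a: "a \<in> interior S"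
    and star: "\<And>x. x \<in> S \<Longrightarrow> open_segment a x \<subseteq> interior S"
    and x: "x \<in> frontier S" and N: "open N" "x \<in> N"
  obtains U where "openin (top_of_set (frontier S)) U" "x \<in> U" "U \<subseteq> N"
    "U homeomorphic (ball (0::real^2) 1)"
proof -
  have ri: "rel_interior S = interior S" using a by (metis empty_iff rel_interior_nonempty_interior)
  have aff: "affine hull S = UNIV" using a affine_hull_nonempty_interior by auto
  have fr: "S - rel_interior S = frontier S"
    using S by (simp add: ri frontier_def compact_imp_closed)
  have "frontier S homeomorphic sphere a 1"
    using starlike_compact_projective1[of S a] S a star unfolding fr unfolding ri aff by simp
  then obtain f g where fg: "homeomorphism (frontier S) (sphere a 1) f g" unfolding homeomorphic_def by auto
  have fx: "f x \<in> sphere a 1" using fg x unfolding homeomorphism_def by auto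
  \<comment> \<open>The antipode of \<open>f x\<close>, used as the puncture because it differs from
    \<open>f x\<close>.\<close>
  define b where "b = a - (f x - a)"
  have b: "b \<in> sphere a 1" "b \<noteq> f x"
  proof -
    show "b \<in> sphere a 1" using fx unfolding b_def by (simp add: dist_norm norm_minus_commute)
    show "b \<noteq> f x"
    proof
      assume "b = f x"
      then have "2 *\<^sub>R (f x - a) = 0" unfolding b_def by (simp add: scaleR_2 algebra_simps)
      then show False using fx by simp
    qed
  qed
  have "sphere a 1 - {b} homeomorphic (UNIV :: (real^2) set)"
    using b by (intro homeomorphic_punctured_sphere_affine) auto
  then obtain h k where hk: "homeomorphism (sphere a 1 - {b}) (UNIV :: (real^2) set) h k"
    unfolding homeomorphic_def by auto
  define D where "D = frontier S - {g b}"
  have "homeomorphism D (sphere a 1 - {b}) f g"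
  proof (rule homeomorphism_of_subsets[OF fg])
    have inv: "\<And>z. z \<in> frontier S \<Longrightarrow> g (f z) = z \<and> f z \<in> sphere a 1"
      "\<And>w. w \<in> sphere a 1 \<Longrightarrow> f (g w) = w \<and> g w \<in> frontier S"
      using fg unfolding homeomorphism_def by auto
    have "w \<in> f ` D" if "w \<in> sphere a 1 - {b}" for w
      using inv(2)[of w] inv(2)[OF b(1)] that unfolding D_def by (metis Diff_iff image_eqI singleton_iff)
    moreover have "f z \<in> sphere a 1 - {b}" if "z \<in> D" for z
      using inv(1)[of z] that unfolding D_def by auto
    ultimately show "f ` D = sphere a 1 - {b}" by blast
  qed (auto simp: D_def)
  from homeomorphism_compose[OF this hk] have hom: "homeomorphism D (UNIV :: (real^2) set) (h \<circ> f) (g \<circ> k)" .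
  have xD: "x \<in> D" using x b fg unfolding D_def homeomorphism_def by auto
  have opD: "openin (top_of_set (frontier S)) D" unfolding D_def by (simp add: openin_delete)
  have "openin (top_of_set (UNIV::(real^2) set)) ((h \<circ> f) ` (D \<inter> N))"
    by (rule homeomorphism_imp_open_map[OF hom]) (use N in \<open>simp add: openin_open_Int\<close>)
  then have "open ((h \<circ> f) ` (D \<inter> N))" by simp
  moreover have "(h \<circ> f) x \<in> (h \<circ> f) ` (D \<inter> N)" using xD N by blast
  ultimately obtain r where r: "r > 0" "ball ((h \<circ> f) x) r \<subseteq> (h \<circ> f) ` (D \<inter> N)"
    using open_contains_ball by blast
  define U where "U = (g \<circ> k) ` ball ((h \<circ> f) x) r"
  have hom2: "homeomorphism (ball ((h \<circ> f) x) r) U (g \<circ> k) (h \<circ> f)"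
    by (rule homeomorphism_of_subsets[OF homeomorphism_symD[OF hom]]) (auto simp: U_def)
  have "openin (top_of_set D) U"
    unfolding U_def by (rule homeomorphism_imp_open_map[OF homeomorphism_symD[OF hom]]) simp
  then have "openin (top_of_set (frontier S)) U" using opD openin_trans by blast
  moreover have "x \<in> U"
    using r(1) xD hom unfolding U_def homeomorphism_def by (metis centre_in_ball image_eqI)
  moreover have "U \<subseteq> N"
  proof
    fix z assume "z \<in> U"
    then obtain w where w: "w \<in> ball ((h \<circ> f) x) r" "z = (g \<circ> k) w" unfolding U_def by auto
    then obtain z' where "z' \<in> D \<inter> N" "w = (h \<circ> f) z'" using r(2) by blast
    then show "z \<in> N" using w hom unfolding homeomorphism_def by (metis Int_iff)
  qed
  moreover have "U homeomorphic ball (0::real^2) 1"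
    using hom2 homeomorphic_balls(1)[OF r(1) zero_less_one] homeomorphic_trans homeomorphic_sym
    unfolding homeomorphic_def by blast
  ultimately show ?thesis using that by blast
qed

text \<open>If membership in \<open>P\<close> near \<open>x\<close> is monotone, up to the signs \<open>v\<close>, in the three truth values
  \<open>0 \<le> v i * (y $ i - x $ i)\<close>, then \<open>P\<close> is starlike near \<open>x\<close> about a point in direction \<open>v\<close>.\<close>

lemma monotone_frontier_disc:
  fixes P :: "(real^3) set"
  assumes P: "closed P" and x: "x \<in> frontier P" and d: "d > 0" and v: "\<And>i. v i = 1 \<or> v i = (-1::real)"
    and mono: "\<And>y w. y \<in> P \<Longrightarrow> \<forall>i. \<bar>y $ i - x $ i\<bar> \<le> d \<Longrightarrow> \<forall>i. \<bar>w $ i - x $ i\<bar> \<le> d \<Longrightarrow>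
       \<forall>i. 0 \<le> v i * (y $ i - x $ i) \<longrightarrow> 0 \<le> v i * (w $ i - x $ i) \<Longrightarrow> w \<in> P"
  obtains U where "openin (top_of_set (frontier P)) U" "x \<in> U" "U homeomorphic (ball (0::real^2) 1)"
proof -
  define K where "K = {y::real^3. \<forall>i. \<bar>y $ i - x $ i\<bar> \<le> d}"
  have Kbox: "K = cbox (\<chi> i. x $ i - d) (\<chi> i. x $ i + d)"
    unfolding K_def by (auto simp: mem_box_cart abs_le_iff algebra_simps)
  define S where "S = P \<inter> K"
  \<comment> \<open>Halfway from \<open>x\<close> to the corner of \<open>K\<close> in direction
    \<open>v\<close>, where all three inequalities hold strictly.\<close>
  define a :: "real^3" where "a = (\<chi> i. x $ i + v i * d / 2)"
  have xP: "x \<in> P" using P x frontier_subset_closed by blast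
  have star: "(1 - u) *\<^sub>R y + u *\<^sub>R a \<in> interior S" if y: "y \<in> S" and u: "0 < u" "u \<le> 1" for y u
  proof -
    \<comment> \<open>The points near \<open>x\<close> that satisfy strictly every inequality which
      \<open>y\<close> satisfies; by monotonicity the intersection over \<open>i\<close> lies in
      \<open>P\<close>. A step from \<open>y\<close> towards \<open>a\<close> enters it because
      \<open>a\<close> satisfies all inequalities strictly.\<close>
    define Q where "Q i = {w::real^3. x $ i - d < w $ i \<and> w $ i < x $ i + d \<and>
        (0 \<le> v i * (y $ i - x $ i) \<longrightarrow> 0 < v i * (w $ i - x $ i))}" for i
    have "open (Q i)" for i
      unfolding Q_def
      by (cases "0 \<le> v i * (y $ i - x $ i)")
        (auto intro!: open_Collect_conj open_Collect_less continuous_intros)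
    then have "open (\<Inter>i. Q i)" by (intro open_INT) auto
    moreover have "(\<Inter>i. Q i) \<subseteq> S"
    proof
      fix w assume "w \<in> (\<Inter>i. Q i)"
      then have w: "x $ i - d < w $ i" "w $ i < x $ i + d"
        "0 \<le> v i * (y $ i - x $ i) \<longrightarrow> 0 < v i * (w $ i - x $ i)" for i
        unfolding Q_def by auto
      have wd: "\<bar>w $ i - x $ i\<bar> \<le> d" for i using w(1,2)[of i] by linarith
      have "w \<in> P"
        by (rule mono[of y]) (use y wd w(3) in \<open>auto simp: S_def K_def less_imp_le\<close>)
      then show "w \<in> S" using wd unfolding S_def K_def by auto
    qed
    moreover have "(1 - u) *\<^sub>R y + u *\<^sub>R a \<in> (\<Inter>i. Q i)"
    proof
      fix i
      define t where "t = v i * (y $ i - x $ i)"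
      let ?w = "(1 - u) *\<^sub>R y + u *\<^sub>R a"
      have vv: "v i * v i = 1" using v[of i] by auto
      have e: "v i * (?w $ i - x $ i) = (1 - u) * t + u * (d / 2)"
      proof -
        have "v i * (?w $ i - x $ i) = (1 - u) * t + u * (v i * v i * d / 2)"
          unfolding a_def t_def by (simp add: algebra_simps)
        then show ?thesis using vv by simp
      qed
      have yd: "\<bar>y $ i - x $ i\<bar> \<le> d" using y unfolding S_def K_def by auto
      then have t: "\<bar>t\<bar> \<le> d" unfolding t_def using v[of i] by auto
      have "(1 - u) * t \<le> (1 - u) * d" using t u by (intro mult_left_mono) auto
      moreover have "(1 - u) * (- d) \<le> (1 - u) * t" using t u by (intro mult_left_mono) auto
      moreover have "0 < u * d" using u d by simp
      ultimately have "v i * (?w $ i - x $ i) < d" "- d < v i * (?w $ i - x $ i)"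
        unfolding e by (simp_all add: algebra_simps)
      then have "\<bar>?w $ i - x $ i\<bar> < d" using v[of i] by auto
      moreover have "0 < v i * (?w $ i - x $ i)" if "0 \<le> t"
        unfolding e using that u d by (intro add_nonneg_pos) auto
      ultimately show "?w \<in> Q i" unfolding Q_def t_def by (simp add: abs_less_iff algebra_simps)
    qed
    ultimately show ?thesis by (meson interiorI)
  qed
  have "x \<in> S" using xP d unfolding S_def K_def by auto
  have a: "a \<in> interior S" using star[OF \<open>x \<in> S\<close>, of 1] by simp
  have comp: "compact S" unfolding S_def Kbox using P by (simp add: closed_Int_compact)
  have seg: "open_segment a y \<subseteq> interior S" if "y \<in> S" for y
  proof
    fix w assume "w \<in> open_segment a y"
    then have "w \<in> open_segment y a" by (simp add: open_segment_commute)
    then obtain u where "0 < u" "u < 1" "w = (1 - u) *\<^sub>R y + u *\<^sub>R a" by (auto simp: in_segment)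
    then show "w \<in> interior S" using star[OF that] by auto
  qed
  have xK: "x \<in> interior K" unfolding Kbox interior_cbox using d by (simp add: mem_box_cart)
  \<comment> \<open>\<open>S\<close> and \<open>P\<close> agree on \<open>K\<close>, so a disc found
    in the interior of \<open>K\<close> transfers from one boundary to the other.\<close>
  have frS: "frontier S \<inter> interior K = frontier P \<inter> interior K"
  proof -
    have "closure S = S" "closure P = P" using comp P by (simp_all add: compact_imp_closed)
    then show ?thesis
      unfolding frontier_def using interior_subset[of K] by (auto simp: S_def interior_Int)
  qed
  obtain U where U: "openin (top_of_set (frontier S)) U" "x \<in> U" "U \<subseteq> interior K"
    "U homeomorphic (ball (0::real^2) 1)"
    using starlike_frontier_disc[OF comp a seg, of x "interior K"] xK x frS by blast
  obtain T where T: "open T" "U = frontier S \<inter> T" using U(1) by (auto simp: openin_open)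
  have "U = frontier P \<inter> (T \<inter> interior K)" using T U(3) frS by blast
  then have "openin (top_of_set (frontier P)) U" using T(1) by (metis open_Int open_interior openin_open_Int)
  then show ?thesis using that U by blast
qed

lemma finite_gap:
  fixes A :: "real set"
  assumes "finite A"
  obtains d where "d > 0" "\<And>a. a \<in> A \<Longrightarrow> a \<noteq> 0 \<Longrightarrow> d < \<bar>a\<bar>"
proof -
  \<comment> \<open>The element 1 keeps the minimum meaningful when no nonzero value occurs; halving
    the minimum makes the bound strict.\<close>
  let ?B = "insert 1 (abs ` (A - {0}))"
  have "finite ?B" using assms by simp
  have m: "Min ?B > 0" using \<open>finite ?B\<close> by (subst Min_gr_iff) auto
  have le: "Min ?B \<le> b" if "b \<in> ?B" for b using \<open>finite ?B\<close> that by (rule Min_le)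
  show ?thesis
  proof (rule that[of "Min ?B / 2"])
    fix a assume "a \<in> A" "a \<noteq> 0"
    then have "Min ?B \<le> \<bar>a\<bar>" by (intro le) auto
    then show "Min ?B / 2 < \<bar>a\<bar>" using m by linarith
  qed (use m in auto)
qed

text \<open>If no box begins where a box ends, the bounds in coordinate \<open>i\<close> that are
  tight at \<open>x\<close> are all lower or all upper ones. Near \<open>x\<close>, membership in
  each box, hence in the union, then depends monotonically on one truth value per coordinate, with
  sign \<open>v i\<close>.\<close>

lemma boxes_two_manifold:
  fixes B :: "((real^3) \<times> (real^3)) set"
  assumes B: "finite B" and disj: "\<And>b b' i. b \<in> B \<Longrightarrow> b' \<in> B \<Longrightarrow> fst b $ i \<noteq> snd b' $ i"
  shows "two_manifold (frontier (\<Union>b\<in>B. cbox (fst b) (snd b)))"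
  unfolding two_manifold_def
proof
  let ?P = "\<Union>b\<in>B. cbox (fst b) (snd b)"
  fix x assume x: "x \<in> frontier ?P"
  have cl: "closed ?P" using B by auto
  \<comment> \<open>Offsets of all box bounds from \<open>x\<close>: within \<open>d\<close> of
    \<open>x\<close> only bounds equal to a coordinate of \<open>x\<close> can be crossed.\<close>
  define A where "A = (\<lambda>(b,i). fst b $ i - x $ i) ` (B \<times> UNIV) \<union> (\<lambda>(b,i). snd b $ i - x $ i) ` (B \<times> UNIV)"
  have "finite A" unfolding A_def using B by auto
  then obtain d where d: "d > 0" "\<And>a. a \<in> A \<Longrightarrow> a \<noteq> 0 \<Longrightarrow> d < \<bar>a\<bar>" using finite_gap by blast
  have gap: "fst b $ i = x $ i \<or> d < \<bar>fst b $ i - x $ i\<bar>" "snd b $ i = x $ i \<or> d < \<bar>snd b $ i - x $ i\<bar>"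
    if "b \<in> B" for b i
    using that d(2)[of "fst b $ i - x $ i"] d(2)[of "snd b $ i - x $ i"] unfolding A_def by force+
  define v where "v i = (if \<exists>b\<in>B. snd b $ i = x $ i then -1 else 1::real)" for i
  have "w \<in> ?P" if y: "y \<in> ?P" "\<forall>i. \<bar>y $ i - x $ i\<bar> \<le> d" and w: "\<forall>i. \<bar>w $ i - x $ i\<bar> \<le> d"
    and vw: "\<forall>i. 0 \<le> v i * (y $ i - x $ i) \<longrightarrow> 0 \<le> v i * (w $ i - x $ i)" for y w
  proof -
    obtain b where b: "b \<in> B" "y \<in> cbox (fst b) (snd b)" using y by auto
    have "fst b $ i \<le> w $ i \<and> w $ i \<le> snd b $ i" for i
    proof -
      have yb: "fst b $ i \<le> y $ i" "y $ i \<le> snd b $ i" using b(2) by (auto simp: mem_box_cart)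
      have le: "\<bar>y $ i - x $ i\<bar> \<le> d" "\<bar>w $ i - x $ i\<bar> \<le> d" using y w by auto
      have "fst b $ i \<le> w $ i"
      proof (cases "fst b $ i = x $ i")
        case True
        then have v1: "v i = 1" using disj[OF b(1)] unfolding v_def by metis
        have "0 \<le> v i * (y $ i - x $ i)" using v1 yb True by simp
        then have "0 \<le> v i * (w $ i - x $ i)" using vw by blast
        then show ?thesis using v1 True by simp
      qed (use gap(1)[OF b(1), of i] yb le in linarith)
      moreover have "w $ i \<le> snd b $ i"
      proof (cases "snd b $ i = x $ i")
        case True
        then have v1: "v i = -1" using b(1) unfolding v_def by auto
        have "0 \<le> v i * (y $ i - x $ i)" using v1 yb True by simp
        then have "0 \<le> v i * (w $ i - x $ i)" using vw by blast
        then show ?thesis using v1 True by simp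
      qed (use gap(2)[OF b(1), of i] yb le in linarith)
      ultimately show ?thesis by blast
    qed
    then show ?thesis using b(1) by (auto simp: mem_box_cart intro!: bexI[of _ b])
  qed
  moreover have "v i = 1 \<or> v i = -1" for i unfolding v_def by auto
  ultimately show "\<exists>U. openin (top_of_set (frontier ?P)) U \<and> x \<in> U \<and> U homeomorphic ball (0::real^2) 1"
    using monotone_frontier_disc[OF cl x d(1), of v] by (metis (no_types, lifting))
qed

section \<open>Unions of boxes as orthogonal polyhedra\<close>

text \<open>Instead of a triangulation, all affinely independent quadruples from \<open>V\<close>
  are taken, overlaps allowed. A subset of \<open>V\<close> of least size whose hull contains
  \<open>x\<close> is affinely independent by Caratheodory and extends to an affine basis inside
  \<open>V\<close>.\<close>

lemma cbox_tetrahedra: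
  fixes a b :: "real^3"
  assumes ab: "\<And>i. a $ i < b $ i"
  obtains \<T> where "finite \<T>" "\<And>T. T \<in> \<T> \<Longrightarrow> tetrahedron T" "cbox a b = \<Union>\<T>"
proof -
  obtain V where V: "finite V" "cbox a b = convex hull V" using closed_interval_as_convex_hull by metis
  have "box a b \<noteq> {}" using ab by (simp add: interval_ne_empty_cart)
  then have "interior (convex hull V) \<noteq> {}" using V(2) by (metis interior_cbox)
  then have "affine hull V = UNIV" using affine_hull_nonempty_interior affine_hull_convex_hull by metis
  define \<T> where "\<T> = (\<lambda>W. convex hull W) ` {W. W \<subseteq> V \<and> card W = 4 \<and> \<not> affine_dependent W}"
  have "x \<in> \<Union>\<T>" if x: "x \<in> convex hull V" for x
  proof -
    obtain S where S: "S \<subseteq> V" "x \<in> convex hull S" and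
      min: "\<And>S'. S' \<subseteq> V \<Longrightarrow> x \<in> convex hull S' \<Longrightarrow> card S \<le> card S'"
      using ex_has_least_nat[of "\<lambda>S. S \<subseteq> V \<and> x \<in> convex hull S" V card] x by auto
    have finS: "finite S" using S V finite_subset by auto
    obtain S' where S': "finite S'" "S' \<subseteq> S" "int (card S') \<le> aff_dim S + 1" "x \<in> convex hull S'"
      using S(2) caratheodory_aff_dim[of S] by auto
    have "card S \<le> card S'" using S' S min by auto
    then have "int (card S) \<le> aff_dim S + 1" using S'(3) by linarith
    then have "\<not> affine_dependent S"
      using affine_independent_iff_card[of S] finS aff_dim_le_card[OF finS] by linarith
    moreover have "S \<noteq> {}" using S by auto
    ultimately obtain W where W: "\<not> affine_dependent W" "S \<subseteq> W" "W \<subseteq> V" "affine hull W = affine hull V"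
      using extend_to_affine_basis_nonempty[of S V] S(1) by auto
    have "aff_dim W = 3" using W(4) \<open>affine hull V = UNIV\<close> aff_dim_eq_full[of W] by simp
    then have "card W = 4" using W(1) affine_independent_iff_card[of W] by auto
    moreover have "x \<in> convex hull W" using S(2) W(2) hull_mono by blast
    ultimately show ?thesis using W unfolding \<T>_def by blast
  qed
  moreover have "\<Union>\<T> \<subseteq> convex hull V" unfolding \<T>_def using hull_mono by blast
  ultimately have "cbox a b = \<Union>\<T>" using V(2) by blast
  moreover have "finite \<T>" unfolding \<T>_def using V(1) by auto
  moreover have "tetrahedron T" if "T \<in> \<T>" for T
    using that V(1) finite_subset unfolding \<T>_def tetrahedron_def by blast
  ultimately show ?thesis using that by blast
qed

text \<open>Either one affine set contains \<open>U\<close> and hence its affine hull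
  \<open>H\<close>, or removing it leaves a nonempty relatively open set covered by the
  others.\<close>

lemma affine_cover_subset:
  fixes H :: "'a::euclidean_space set"
  assumes "finite I" "affine H" "openin (top_of_set H) U" "U \<noteq> {}" "U \<subseteq> (\<Union>i\<in>I. A i)"
    "\<And>i. i \<in> I \<Longrightarrow> affine (A i)"
  shows "\<exists>i\<in>I. H \<subseteq> A i"
  using assms(1,3-6)
proof (induction I arbitrary: U)
  case (insert p I)
  show ?case
  proof (cases "U \<subseteq> A p")
    case True
    have "H = affine hull U"
      using affine_hull_openin[of H U] insert.prems(1,2) assms(2) by (simp add: hull_same)
    then have "H \<subseteq> A p" using True insert.prems(4) by (simp add: hull_minimal)
    then show ?thesis by blast
  next
    case False
    have "closed (A p)" using insert.prems(4) by (simp add: affine_closed)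
    then have "openin (top_of_set H) (U - A p)"
      using insert.prems(1) by (simp add: Diff_eq openin_Int_open open_Compl)
    then show ?thesis using insert.IH[of "U - A p"] False insert.prems by auto
  qed
qed auto

text \<open>The relative interior is open in the plane of the face, so
  \<open>affine_cover_subset\<close> puts that plane into a single axis plane. This is the converse
  passage to \<open>orthogonal_axis_arrangement\<close>.\<close>

lemma face_in_axis_plane:
  assumes C: "finite C" "\<And>x. x \<in> frontier P \<Longrightarrow> \<exists>i. x $ i \<in> C" and F: "F \<in> faces P"
  obtains i c where "c \<in> C" "F \<subseteq> axis_plane i c"
proof -
  have "rel_interior F \<subseteq> (\<Union>(i,c)\<in>UNIV \<times> C. axis_plane i c)"
    using C(2) faceD(1)[OF F] rel_interior_subset unfolding axis_plane_def by fastforce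
  moreover have "finite ((UNIV::3 set) \<times> C)" using C(1) by auto
  ultimately obtain p where p: "p \<in> UNIV \<times> C" "affine hull F \<subseteq> (\<lambda>(i,c). axis_plane i c) p"
    using affine_cover_subset[of "UNIV \<times> C" "affine hull F" "rel_interior F" "\<lambda>(i,c). axis_plane i c"]
      openin_rel_interior[of F] faceD(3)[OF F] by fastforce
  then show ?thesis using that[of "snd p" "fst p"] hull_subset[of F affine] by (auto simp: case_prod_beta)
qed

lemma boxes_frontier_coordinate:
  fixes B :: "((real^3) \<times> (real^3)) set"
  assumes "finite B" "x \<in> frontier (\<Union>b\<in>B. cbox (fst b) (snd b))"
  obtains b i where "b \<in> B" "x $ i = fst b $ i \<or> x $ i = snd b $ i"
proof -
  have "x \<in> (\<Union>t\<in>(\<lambda>b. cbox (fst b) (snd b)) ` B. frontier t)"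
    using frontier_Union_subset[of "(\<lambda>b. cbox (fst b) (snd b)) ` B"] assms by blast
  then obtain b where b: "b \<in> B" "x \<in> frontier (cbox (fst b) (snd b))" by auto
  then have "x \<in> cbox (fst b) (snd b)" "x \<notin> box (fst b) (snd b)"
    by (auto simp: frontier_def interior_cbox)
  then obtain i where "fst b $ i \<le> x $ i" "x $ i \<le> snd b $ i" "\<not> (fst b $ i < x $ i \<and> x $ i < snd b $ i)"
    unfolding mem_box_cart by blast
  then have "x $ i = fst b $ i \<or> x $ i = snd b $ i" by linarith
  then show ?thesis using that b by blast
qed

lemma boxes_orthogonal_polyhedron:
  fixes B :: "((real^3) \<times> (real^3)) set"
  assumes B: "finite B" and pos: "\<And>b i. b \<in> B \<Longrightarrow> fst b $ i < snd b $ i"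
    and disj: "\<And>b b' i. b \<in> B \<Longrightarrow> b' \<in> B \<Longrightarrow> fst b $ i \<noteq> snd b' $ i"
    and con: "connected (\<Union>b\<in>B. cbox (fst b) (snd b))"
  shows "orthogonal_polyhedron (\<Union>b\<in>B. cbox (fst b) (snd b))"
proof -
  let ?P = "\<Union>b\<in>B. cbox (fst b) (snd b)"
  have "\<exists>\<T>. finite \<T> \<and> (\<forall>T\<in>\<T>. tetrahedron T) \<and> cbox (fst b) (snd b) = \<Union>\<T>" if "b \<in> B" for b
    using cbox_tetrahedra[of "fst b" "snd b"] pos[OF that] by metis
  then obtain \<T> where T: "\<And>b. b \<in> B \<Longrightarrow> finite (\<T> b) \<and> (\<forall>T\<in>\<T> b. tetrahedron T) \<and> cbox (fst b) (snd b) = \<Union>(\<T> b)"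
    by metis
  have "polyhedron ?P"
    unfolding polyhedron_def
  proof (intro conjI con exI)
    show "finite (\<Union>b\<in>B. \<T> b)" using B T by auto
    show "\<forall>T\<in>(\<Union>b\<in>B. \<T> b). tetrahedron T" using T by auto
    show "?P = \<Union>(\<Union>b\<in>B. \<T> b)" using T by auto
    show "two_manifold (frontier ?P)" by (rule boxes_two_manifold[OF B disj])
  qed
  moreover have "\<exists>i c. F \<subseteq> {x. x $ i = c}" if F: "F \<in> faces ?P" for F
  proof -
    define C where "C = (\<lambda>(b,i). fst b $ i) ` (B \<times> UNIV) \<union> (\<lambda>(b,i). snd b $ i) ` (B \<times> UNIV)"
    have "finite C" unfolding C_def using B by auto
    moreover have "\<exists>i. x $ i \<in> C" if x: "x \<in> frontier ?P" for x
    proof -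
      obtain b i where bi: "b \<in> B" "x $ i = fst b $ i \<or> x $ i = snd b $ i"
        using boxes_frontier_coordinate[OF B x] by blast
      then have "fst b $ i \<in> C" "snd b $ i \<in> C" unfolding C_def by (auto intro!: image_eqI[of _ _ "(b,i)"])
      then have "x $ i \<in> C" using bi(2) by auto
      then show ?thesis by blast
    qed
    ultimately obtain i c where "F \<subseteq> axis_plane i c" using face_in_axis_plane[OF _ _ F] by blast
    then show ?thesis unfolding axis_plane_def by blast
  qed
  ultimately show ?thesis unfolding orthogonal_polyhedron_def by blast
qed

section \<open>The rack\<close>

text \<open>A slab with \<open>k\<close> arms reaching out to the right, each carrying a post that points upwards. The arms
  are extended back through the slab so that in each coordinate no lower bound of a box is an upper
  bound of another; this makes the boundary a manifold.\<close>

definition slab_box :: "nat \<Rightarrow> (real^3) \<times> (real^3)" where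
  "slab_box k = (vector [0, 0, 0], vector [1, 2 * real k + 1, 2])"

definition arm_box :: "nat \<Rightarrow> (real^3) \<times> (real^3)" where
  "arm_box j = (vector [0, 2 * real j + 1, 1], vector [3, 2 * real j + 2, 2])"

text \<open>The post starts at height 1, inside the arm; starting at height 2 would make its lower
  bound an upper bound of the arm.\<close>

definition post_box :: "nat \<Rightarrow> (real^3) \<times> (real^3)" where
  "post_box j = (vector [2, 2 * real j + 1, 1], vector [3, 2 * real j + 2, 3])"

definition rack_boxes :: "nat \<Rightarrow> ((real^3) \<times> (real^3)) set" where
  "rack_boxes k = insert (slab_box k) (arm_box ` {..<k} \<union> post_box ` {..<k})"

definition rack :: "nat \<Rightarrow> (real^3) set" where
  "rack k = (\<Union>b\<in>rack_boxes k. cbox (fst b) (snd b))"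

lemma mem_slab: "p \<in> cbox (fst (slab_box k)) (snd (slab_box k)) \<longleftrightarrow>
    0 \<le> p $ 1 \<and> p $ 1 \<le> 1 \<and> 0 \<le> p $ 2 \<and> p $ 2 \<le> 2 * real k + 1 \<and> 0 \<le> p $ 3 \<and> p $ 3 \<le> 2"
  by (simp add: slab_box_def mem_box_cart forall_3)

lemma mem_arm: "p \<in> cbox (fst (arm_box j)) (snd (arm_box j)) \<longleftrightarrow>
    0 \<le> p $ 1 \<and> p $ 1 \<le> 3 \<and> 2 * real j + 1 \<le> p $ 2 \<and> p $ 2 \<le> 2 * real j + 2 \<and> 1 \<le> p $ 3 \<and> p $ 3 \<le> 2"
  by (simp add: arm_box_def mem_box_cart forall_3)

lemma mem_post: "p \<in> cbox (fst (post_box j)) (snd (post_box j)) \<longleftrightarrow>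
    2 \<le> p $ 1 \<and> p $ 1 \<le> 3 \<and> 2 * real j + 1 \<le> p $ 2 \<and> p $ 2 \<le> 2 * real j + 2 \<and> 1 \<le> p $ 3 \<and> p $ 3 \<le> 3"
  by (simp add: post_box_def mem_box_cart forall_3)

lemma mem_rack: "p \<in> rack k \<longleftrightarrow>
    0 \<le> p $ 1 \<and> p $ 1 \<le> 1 \<and> 0 \<le> p $ 2 \<and> p $ 2 \<le> 2 * real k + 1 \<and> 0 \<le> p $ 3 \<and> p $ 3 \<le> 2 \<or>
    (\<exists>j<k. 2 * real j + 1 \<le> p $ 2 \<and> p $ 2 \<le> 2 * real j + 2 \<and> 1 \<le> p $ 3 \<and>
      (0 \<le> p $ 1 \<and> p $ 1 \<le> 3 \<and> p $ 3 \<le> 2 \<or> 2 \<le> p $ 1 \<and> p $ 1 \<le> 3 \<and> p $ 3 \<le> 3))"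
  unfolding rack_def rack_boxes_def by (auto simp: mem_slab mem_arm mem_post)

lemma mem_rackE:
  assumes "p \<in> rack k"
  obtains (slab) "0 \<le> p $ 1" "p $ 1 \<le> 1" "0 \<le> p $ 2" "p $ 2 \<le> 2 * real k + 1" "0 \<le> p $ 3" "p $ 3 \<le> 2"
  | (arm) j where "j < k" "2 * real j + 1 \<le> p $ 2" "p $ 2 \<le> 2 * real j + 2" "1 \<le> p $ 3"
      "0 \<le> p $ 1" "p $ 1 \<le> 3" "p $ 3 \<le> 2"
  | (post) j where "j < k" "2 * real j + 1 \<le> p $ 2" "p $ 2 \<le> 2 * real j + 2" "1 \<le> p $ 3"
      "2 \<le> p $ 1" "p $ 1 \<le> 3" "p $ 3 \<le> 3"
  using assms unfolding mem_rack by blast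

lemma interior_rack:
  assumes "b \<in> rack_boxes k" "p \<in> box (fst b) (snd b)"
  shows "p \<in> interior (rack k)"
proof -
  have "box (fst b) (snd b) \<subseteq> rack k" using assms(1) box_subset_cbox unfolding rack_def by blast
  then show ?thesis using assms(2) by (meson interiorI open_box)
qed

lemma interior_rack_slab:
  assumes "0 < p $ 1" "p $ 1 < 1" "0 < p $ 2" "p $ 2 < 2 * real k + 1" "0 < p $ 3" "p $ 3 < 2"
  shows "p \<in> interior (rack k)"
  by (rule interior_rack[of "slab_box k"])
    (use assms in \<open>auto simp: rack_boxes_def slab_box_def mem_box_cart forall_3\<close>)

lemma interior_rack_arm:
  assumes "j < k" "0 < p $ 1" "p $ 1 < 3" "2 * real j + 1 < p $ 2" "p $ 2 < 2 * real j + 2" "1 < p $ 3" "p $ 3 < 2"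
  shows "p \<in> interior (rack k)"
  by (rule interior_rack[of "arm_box j"])
    (use assms in \<open>auto simp: rack_boxes_def arm_box_def mem_box_cart forall_3\<close>)

lemma interior_rack_post:
  assumes "j < k" "2 < p $ 1" "p $ 1 < 3" "2 * real j + 1 < p $ 2" "p $ 2 < 2 * real j + 2" "1 < p $ 3" "p $ 3 < 3"
  shows "p \<in> interior (rack k)"
  by (rule interior_rack[of "post_box j"])
    (use assms in \<open>auto simp: rack_boxes_def post_box_def mem_box_cart forall_3\<close>)

lemma rack_orthogonal_polyhedron: "orthogonal_polyhedron (rack k)"
  unfolding rack_def
proof (rule boxes_orthogonal_polyhedron)
  show "finite (rack_boxes k)" unfolding rack_boxes_def by auto
  have "\<forall>i. fst b $ i < snd b $ i" if "b \<in> rack_boxes k" for b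
    using that unfolding rack_boxes_def slab_box_def arm_box_def post_box_def forall_3 by auto
  then show "fst b $ i < snd b $ i" if "b \<in> rack_boxes k" for b i using that by blast
  \<comment> \<open>In the second coordinate arms begin at odd and end at even integers; the odd
    upper bound \<open>2 * real k + 1\<close> of the slab exceeds the beginning of every
    arm.\<close>
  have nat: "2 * real j + 1 \<noteq> 2 * real j' + 2" for j j'
  proof
    assume "2 * real j + 1 = 2 * real j' + 2"
    then have "real (2 * j + 1) = real (2 * j' + 2)" by simp
    then have "2 * j + 1 = 2 * j' + 2" by (simp only: of_nat_eq_iff)
    then show False by presburger
  qed
  have "\<forall>i. fst b $ i \<noteq> snd b' $ i" if "b \<in> rack_boxes k" "b' \<in> rack_boxes k" for b b'
    using that nat nat[symmetric] unfolding rack_boxes_def slab_box_def arm_box_def post_box_def forall_3 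
    by (auto simp: add_nonneg_eq_0_iff)
  then show "fst b $ i \<noteq> snd b' $ i" if "b \<in> rack_boxes k" "b' \<in> rack_boxes k" for b b' i
    using that by blast
  let ?c = "\<lambda>b. cbox (fst b) (snd b) :: (real^3) set"
  let ?S = "insert (?c (slab_box k)) ((\<lambda>j. ?c (slab_box k) \<union> ?c (arm_box j) \<union> ?c (post_box j)) ` {..<k})"
  have con: "connected (?c b)" for b by (simp add: convex_connected convex_box)
  have "connected (?c (slab_box k) \<union> ?c (arm_box j) \<union> ?c (post_box j))" if "j < k" for j
  proof (intro connected_Un con)
    have "(vector [0, 2 * real j + 1, 1] :: real^3) \<in> ?c (slab_box k) \<inter> ?c (arm_box j)"
      using that by (simp add: mem_slab mem_arm)
    then show "?c (slab_box k) \<inter> ?c (arm_box j) \<noteq> {}" by blast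
    have "(vector [2, 2 * real j + 1, 1] :: real^3) \<in> ?c (arm_box j) \<inter> ?c (post_box j)"
      by (simp add: mem_arm mem_post)
    then show "(?c (slab_box k) \<union> ?c (arm_box j)) \<inter> ?c (post_box j) \<noteq> {}" by blast
  qed
  moreover have "0 \<in> \<Inter>?S" by (auto simp: mem_slab)
  ultimately have "connected (\<Union>?S)" using con by (intro connected_Union) auto
  moreover have "\<Union>?S = (\<Union>b\<in>rack_boxes k. ?c b)" unfolding rack_boxes_def by auto
  ultimately show "connected (\<Union>b\<in>rack_boxes k. ?c b)" by simp
qed

section \<open>Counting the faces of the rack\<close>

text \<open>The trace on a plane of a union of open boxes. Boxes are thickened across the plane, so
  that their traces are relatively open rectangles, and several of them together describe an
  L-shaped or comb-shaped region.\<close>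

definition patch :: "3 \<times> real \<times> ((real^3) \<times> (real^3)) list \<Rightarrow> (real^3) set" where
  "patch = (\<lambda>(i, c, L). axis_plane i c \<inter> (\<Union>b\<in>set L. box (fst b) (snd b)))"

definition patch_plane :: "3 \<times> real \<times> ((real^3) \<times> (real^3)) list \<Rightarrow> (real^3) set" where
  "patch_plane = (\<lambda>(i, c, L). axis_plane i c)"

lemma openin_patch: "openin (top_of_set (patch_plane p)) (patch p)"
  unfolding patch_def patch_plane_def by (auto split: prod.split simp: openin_open_Int open_UN)

text \<open>The first box of the list is a hub: its trace meets the trace of every other
  box.\<close>

lemma connected_patch:
  assumes "\<And>b. b \<in> set L \<Longrightarrow> axis_plane i c \<inter> box (fst b) (snd b) \<inter> box (fst b0) (snd b0) \<noteq> {}"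
  shows "connected (patch (i, c, b0 # L))"
proof -
  let ?B = "\<lambda>b. axis_plane i c \<inter> box (fst b) (snd b)"
  have con: "connected (?B b)" for b
    by (intro convex_connected convex_Int) (auto simp: affine_imp_convex convex_box)
  have "connected (\<Union>(insert (?B b0) ((\<lambda>b. ?B b0 \<union> ?B b) ` set L)))"
  proof (cases "L = []")
    case False
    then obtain b where "b \<in> set L" by (metis last_in_set)
    then have "?B b0 \<noteq> {}" using assms by blast
    moreover have "connected (?B b0 \<union> ?B b)" if "b \<in> set L" for b
      using assms[OF that] by (intro connected_Un con) blast
    ultimately show ?thesis using con by (intro connected_Union) auto
  qed (use con in simp)
  moreover have "\<Union>(insert (?B b0) ((\<lambda>b. ?B b0 \<union> ?B b) ` set L)) = patch (i, c, b0 # L)"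
    unfolding patch_def by auto
  ultimately show ?thesis by simp
qed

text \<open>The points just off \<open>x\<close> in direction \<open>s\<close> along axis
  \<open>i\<close> lie outside \<open>P\<close> and converge to \<open>x\<close>.\<close>

lemma frontierI_direction:
  fixes P :: "(real^3) set"
  assumes "x \<in> P" and out: "\<And>t. 0 < t \<Longrightarrow> t < 1 \<Longrightarrow> x + (t * s) *\<^sub>R axis i 1 \<notin> P"
  shows "x \<in> frontier P"
proof -
  have "((\<lambda>t. x + (t * s) *\<^sub>R axis i 1) \<longlongrightarrow> x + (0 * s) *\<^sub>R axis i 1) (at_right 0)"
    by (intro tendsto_intros)
  then have lim: "((\<lambda>t. x + (t * s) *\<^sub>R axis i 1) \<longlongrightarrow> x) (at_right 0)" by simp
  have "x + (t * s) *\<^sub>R axis i 1 \<in> closure (- P)" if "0 < t" "t < 1" for t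
    using out[OF that] closure_subset[of "- P"] by auto
  then have "\<forall>\<^sub>F t in at_right 0. x + (t * s) *\<^sub>R axis i 1 \<in> closure (- P)"
    unfolding eventually_at_right[OF zero_less_one] using zero_less_one by blast
  then have "x \<in> closure (- P)"
    using Lim_in_closed_set[OF closed_closure _ trivial_limit_at_right_real lim] by blast
  moreover have "x \<in> closure P" using assms(1) closure_subset by blast
  ultimately show ?thesis by (simp add: frontier_closures)
qed

text \<open>The hypotheses amount to \<open>i < j < i + 1\<close> for natural numbers.\<close>

lemma between_arms:
  assumes "2 * real j < y" "y < 2 * real j + 1" "2 * real i + 1 \<le> y" "y \<le> 2 * real i + 2"
  shows False
proof -
  have "real j < real (i + 1)" "real i < real j" using assms by auto
  then show False by (simp only: of_nat_less_iff)
qed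

text \<open>In order: left side, right side, the two ends, bottom and top. The right side is the
  strip below the arms joined with the \<open>k + 1\<close> pieces beside and between them, whence
  \<open>Suc k\<close>; the top includes the tops of all arms up to the posts.\<close>

definition slab_patches :: "nat \<Rightarrow> (3 \<times> real \<times> ((real^3) \<times> (real^3)) list) set" where
  "slab_patches k = {(1, 0, [(vector [-1, 0, 0], vector [1, 2 * real k + 1, 2])]),
     (1, 1, (vector [0, 0, 0], vector [2, 2 * real k + 1, 1]) #
        map (\<lambda>j. (vector [0, 2 * real j, 0], vector [2, 2 * real j + 1, 2])) [0..<Suc k]),
     (2, 0, [(vector [0, -1, 0], vector [1, 1, 2])]),
     (2, 2 * real k + 1, [(vector [0, 0, 0], vector [1, 2 * real k + 2, 2])]),
     (3, 0, [(vector [0, 0, -1], vector [1, 2 * real k + 1, 1])]),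
     (3, 2, (vector [0, 0, 1], vector [1, 2 * real k + 1, 3]) #
        map (\<lambda>j. (vector [0, 2 * real j + 1, 1], vector [2, 2 * real j + 2, 3])) [0..<k])}"

text \<open>In order: bottom, the two L-shaped sides, outer end, top of the post, and inner wall of
  the post.\<close>

definition arm_patches :: "nat \<Rightarrow> (3 \<times> real \<times> ((real^3) \<times> (real^3)) list) set" where
  "arm_patches j = {(3, 1, [(vector [1, 2 * real j + 1, 0], vector [3, 2 * real j + 2, 2])]),
     (2, 2 * real j + 1, [(vector [1, 2 * real j, 1], vector [3, 2 * real j + 2, 2]),
        (vector [2, 2 * real j, 1], vector [3, 2 * real j + 2, 3])]),
     (2, 2 * real j + 2, [(vector [1, 2 * real j + 1, 1], vector [3, 2 * real j + 3, 2]),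
        (vector [2, 2 * real j + 1, 1], vector [3, 2 * real j + 3, 3])]),
     (1, 3, [(vector [2, 2 * real j + 1, 1], vector [4, 2 * real j + 2, 3])]),
     (3, 3, [(vector [2, 2 * real j + 1, 2], vector [3, 2 * real j + 2, 4])]),
     (1, 2, [(vector [1, 2 * real j + 1, 2], vector [3, 2 * real j + 2, 3])])}"

lemma mem_patch: "x \<in> patch (i, c, L) \<longleftrightarrow> x $ i = c \<and> (\<exists>b\<in>set L. x \<in> box (fst b) (snd b))"
  unfolding patch_def axis_plane_def by auto

lemma mem_box_vector: "x \<in> box (vector [a, b, c]) (vector [a', b', c'] :: real^3) \<longleftrightarrow>
    a < x $ 1 \<and> x $ 1 < a' \<and> b < x $ 2 \<and> x $ 2 < b' \<and> c < x $ 3 \<and> x $ 3 < c'"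
  by (auto simp: mem_box_cart forall_3)

lemma axis_3_nth: "axis i (1::real) $ j = (if i = j then 1 else 0)"
  by (simp add: axis_def)

lemma index_3_neq: "(1::3) \<noteq> 2" "(2::3) \<noteq> 1" "(1::3) \<noteq> 3" "(3::3) \<noteq> 1" "(2::3) \<noteq> 3" "(3::3) \<noteq> 2"
  by simp_all

lemma card_le_6: "card {a, b, c, d, e, f} \<le> 6"
  using card_length[of "[a, b, c, d, e, f]"] by simp

lemma slab_patch_frontier:
  assumes "p \<in> slab_patches k"
  shows "patch p \<subseteq> frontier (rack k)"
proof -
  note defs = mem_rack axis_3_nth index_3_neq mem_patch mem_box_vector
  have gap: False if "2 * real j < y" "y < 2 * real j + 1" "2 * real i + 1 \<le> y" "y \<le> 2 * real i + 2" for i j y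
    using between_arms that by blast
  consider
    (a) "p = (1, 0, [(vector [-1, 0, 0], vector [1, 2 * real k + 1, 2])])"
  | (b) "p = (1, 1, (vector [0, 0, 0], vector [2, 2 * real k + 1, 1]) #
        map (\<lambda>j. (vector [0, 2 * real j, 0], vector [2, 2 * real j + 1, 2])) [0..<Suc k])"
  | (c) "p = (2, 0, [(vector [0, -1, 0], vector [1, 1, 2])])"
  | (d) "p = (2, 2 * real k + 1, [(vector [0, 0, 0], vector [1, 2 * real k + 2, 2])])"
  | (e) "p = (3, 0, [(vector [0, 0, -1], vector [1, 2 * real k + 1, 1])])"
  | (f) "p = (3, 2, (vector [0, 0, 1], vector [1, 2 * real k + 1, 3]) #
        map (\<lambda>j. (vector [0, 2 * real j + 1, 1], vector [2, 2 * real j + 2, 3])) [0..<k])"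
    using assms unfolding slab_patches_def by blast
  then show ?thesis
  proof cases
    case a
    show ?thesis
    proof
      fix x assume "x \<in> patch p"
      then have x: "x $ 1 = 0" "0 < x $ 2" "x $ 2 < 2 * real k + 1" "0 < x $ 3" "x $ 3 < 2"
        unfolding a by (auto simp: defs)
      show "x \<in> frontier (rack k)"
        by (rule frontierI_direction[where i = 1 and s = "-1"]) (use x in \<open>auto simp: defs\<close>)
    qed
  next
    case b
    show ?thesis
    proof
      fix x assume "x \<in> patch p"
      then consider "x $ 1 = 1" "0 < x $ 2" "x $ 2 < 2 * real k + 1" "0 < x $ 3" "x $ 3 < 1"
        | j where "j \<le> k" "x $ 1 = 1" "2 * real j < x $ 2" "x $ 2 < 2 * real j + 1" "0 < x $ 3" "x $ 3 < 2"
        unfolding b by (auto simp: defs less_Suc_eq_le simp del: upt_Suc)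
      then show "x \<in> frontier (rack k)"
      proof cases
        case 1
        then show ?thesis
          by (intro frontierI_direction[where i = 1 and s = 1]) (auto simp: defs)
      next
        case 2
        then have "real j \<le> real k" by simp
        then have "x \<in> rack k" using 2 by (simp add: defs)
        \<comment> \<open>To the right of the slab at this second coordinate there is a gap, so no
          arm or post is entered.\<close>
        moreover have "x + (t * 1) *\<^sub>R axis 1 1 \<notin> rack k" if "0 < t" "t < 1" for t
          using 2 that gap[of j "x $ 2"] by (auto simp: defs)
        ultimately show ?thesis by (rule frontierI_direction)
      qed
    qed
  next
    case c
    show ?thesis
    proof
      fix x assume "x \<in> patch p"
      then have x: "x $ 2 = 0" "0 < x $ 1" "x $ 1 < 1" "0 < x $ 3" "x $ 3 < 2"
        unfolding c by (auto simp: defs)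
      show "x \<in> frontier (rack k)"
        by (rule frontierI_direction[where i = 2 and s = "-1"]) (use x in \<open>auto simp: defs\<close>)
    qed
  next
    case d
    show ?thesis
    proof
      fix x assume "x \<in> patch p"
      then have x: "x $ 2 = 2 * real k + 1" "0 < x $ 1" "x $ 1 < 1" "0 < x $ 3" "x $ 3 < 2"
        unfolding d by (auto simp: defs)
      \<comment> \<open>The last arm ends at \<open>2 * real k\<close>, short of this end of the
        slab.\<close>
      have "real j + 1 \<le> real k" if "j < k" for j using that by simp
      then show "x \<in> frontier (rack k)"
        by (intro frontierI_direction[where i = 2 and s = 1]) (use x in \<open>fastforce simp: defs\<close>)+
    qed
  next
    case e
    show ?thesis
    proof
      fix x assume "x \<in> patch p"
      then have x: "x $ 3 = 0" "0 < x $ 1" "x $ 1 < 1" "0 < x $ 2" "x $ 2 < 2 * real k + 1"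
        unfolding e by (auto simp: defs)
      show "x \<in> frontier (rack k)"
        by (rule frontierI_direction[where i = 3 and s = "-1"]) (use x in \<open>auto simp: defs\<close>)
    qed
  next
    case f
    show ?thesis
    proof
      fix x assume "x \<in> patch p"
      then consider "x $ 3 = 2" "0 < x $ 2" "x $ 2 < 2 * real k + 1" "0 < x $ 1" "x $ 1 < 1"
        | j where "j < k" "x $ 3 = 2" "2 * real j + 1 < x $ 2" "x $ 2 < 2 * real j + 2" "0 < x $ 1" "x $ 1 < 2"
        unfolding f by (auto simp: defs)
      then show "x \<in> frontier (rack k)"
      proof cases
        case 1
        then show ?thesis
          by (intro frontierI_direction[where i = 3 and s = 1]) (auto simp: defs)
      next
        case 2
        then have "x \<in> rack k" by (auto simp: defs intro!: exI[of _ j])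
        moreover have "x + (t * 1) *\<^sub>R axis 3 1 \<notin> rack k" if "0 < t" "t < 1" for t
          using 2 that by (auto simp: defs)
        ultimately show ?thesis by (rule frontierI_direction)
      qed
    qed
  qed
qed

lemma arm_patch_frontier:
  assumes p: "p \<in> arm_patches j" and j: "j < k"
  shows "patch p \<subseteq> frontier (rack k)"
proof
  fix x assume x: "x \<in> patch p"
  note defs = mem_rack axis_3_nth index_3_neq mem_patch mem_box_vector
  have gap: False if "2 * real j < y" "y < 2 * real j + 1" "2 * real i + 1 \<le> y" "y \<le> 2 * real i + 2" for i j y
    using between_arms that by blast
  have k: "real j + 1 \<le> real k" using j by simp
  consider
    (a) "x $ 3 = 1" "1 < x $ 1" "x $ 1 < 3" "2 * real j + 1 < x $ 2" "x $ 2 < 2 * real j + 2"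
  | (b) "x $ 2 = 2 * real j + 1" "1 < x $ 1" "x $ 1 < 3" "1 < x $ 3" "x $ 3 < 3" "x $ 3 < 2 \<or> 2 < x $ 1"
  | (c) "x $ 2 = 2 * real j + 2" "1 < x $ 1" "x $ 1 < 3" "1 < x $ 3" "x $ 3 < 3" "x $ 3 < 2 \<or> 2 < x $ 1"
  | (d) "x $ 1 = 3" "2 * real j + 1 < x $ 2" "x $ 2 < 2 * real j + 2" "1 < x $ 3" "x $ 3 < 3"
  | (e) "x $ 3 = 3" "2 < x $ 1" "x $ 1 < 3" "2 * real j + 1 < x $ 2" "x $ 2 < 2 * real j + 2"
  | (f) "x $ 1 = 2" "2 * real j + 1 < x $ 2" "x $ 2 < 2 * real j + 2" "2 < x $ 3" "x $ 3 < 3"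
    using p x unfolding arm_patches_def by (auto simp: defs)
  then show "x \<in> frontier (rack k)"
  proof cases
    case a
    then have "x \<in> rack k" using j by (auto simp: defs intro!: exI[of _ j])
    moreover have "x + (t * (-1)) *\<^sub>R axis 3 1 \<notin> rack k" if "0 < t" "t < 1" for t
      using a that by (auto simp: defs)
    ultimately show ?thesis by (rule frontierI_direction)
  next
    case b
    then have "x \<in> rack k" using j by (auto simp: defs intro!: exI[of _ j])
    \<comment> \<open>For \<open>0 < t < 1\<close> the second coordinate falls into the gap before
      arm \<open>j\<close>; on the opposite side of the arm it is the gap of index
      \<open>j + 1\<close>.\<close>
    moreover have "x + (t * (-1)) *\<^sub>R axis 2 1 \<notin> rack k" if "0 < t" "t < 1" for t
      using b that gap[of j "2 * real j + 1 - t"] by (auto simp: defs)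
    ultimately show ?thesis by (rule frontierI_direction)
  next
    case c
    then have "x \<in> rack k" using j by (auto simp: defs intro!: exI[of _ j])
    moreover have "x + (t * 1) *\<^sub>R axis 2 1 \<notin> rack k" if "0 < t" "t < 1" for t
      using c that gap[of "j + 1" "2 * real j + 2 + t"] by (auto simp: defs)
    ultimately show ?thesis by (rule frontierI_direction)
  next
    case d
    then have "x \<in> rack k" using j by (auto simp: defs intro!: exI[of _ j])
    moreover have "x + (t * 1) *\<^sub>R axis 1 1 \<notin> rack k" if "0 < t" "t < 1" for t
      using d that by (auto simp: defs)
    ultimately show ?thesis by (rule frontierI_direction)
  next
    case e
    then have "x \<in> rack k" using j by (auto simp: defs intro!: exI[of _ j])
    moreover have "x + (t * 1) *\<^sub>R axis 3 1 \<notin> rack k" if "0 < t" "t < 1" for t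
      using e that by (auto simp: defs)
    ultimately show ?thesis by (rule frontierI_direction)
  next
    case f
    then have "x \<in> rack k" using j by (auto simp: defs intro!: exI[of _ j])
    moreover have "x + (t * (-1)) *\<^sub>R axis 1 1 \<notin> rack k" if "0 < t" "t < 1" for t
      using f that by (auto simp: defs)
    ultimately show ?thesis by (rule frontierI_direction)
  qed
qed

lemma slab_patch_connected:
  assumes "p \<in> slab_patches k"
  shows "connected (patch p)"
proof -
  have "connected (patch (i, c, [b]))" for i c b by (rule connected_patch) simp
  moreover have "connected (patch (1, 1, (vector [0, 0, 0], vector [2, 2 * real k + 1, 1]) #
        map (\<lambda>j. (vector [0, 2 * real j, 0], vector [2, 2 * real j + 1, 2])) [0..<Suc k]))"
  proof (rule connected_patch)
    fix b assume "b \<in> set (map (\<lambda>j. (vector [0, 2 * real j, 0] :: real^3, vector [2, 2 * real j + 1, 2] :: real^3)) [0..<Suc k])"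
    then obtain j where j: "j \<le> k" "b = (vector [0, 2 * real j, 0], vector [2, 2 * real j + 1, 2])"
      by (auto simp: less_Suc_eq_le simp del: upt_Suc)
    then have "vector [1, 2 * real j + 1 / 2, 1 / 2] \<in> axis_plane 1 1 \<inter> box (fst b) (snd b) \<inter>
        box (fst (vector [0, 0, 0], vector [2, 2 * real k + 1, 1] :: real^3)) (snd (vector [0, 0, 0] :: real^3, vector [2, 2 * real k + 1, 1]))"
      by (simp add: axis_plane_def mem_box_vector)
    then show "axis_plane 1 1 \<inter> box (fst b) (snd b) \<inter>
        box (fst (vector [0, 0, 0], vector [2, 2 * real k + 1, 1] :: real^3)) (snd (vector [0, 0, 0] :: real^3, vector [2, 2 * real k + 1, 1])) \<noteq> {}"
      by blast
  qed
  moreover have "connected (patch (3, 2, (vector [0, 0, 1], vector [1, 2 * real k + 1, 3]) #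
        map (\<lambda>j. (vector [0, 2 * real j + 1, 1], vector [2, 2 * real j + 2, 3])) [0..<k]))"
  proof (rule connected_patch)
    fix b assume "b \<in> set (map (\<lambda>j. (vector [0, 2 * real j + 1, 1] :: real^3, vector [2, 2 * real j + 2, 3] :: real^3)) [0..<k])"
    then obtain j where j: "j < k" "b = (vector [0, 2 * real j + 1, 1], vector [2, 2 * real j + 2, 3])"
      by auto
    then have "vector [1 / 2, 2 * real j + 3 / 2, 2] \<in> axis_plane 3 2 \<inter> box (fst b) (snd b) \<inter>
        box (fst (vector [0, 0, 1], vector [1, 2 * real k + 1, 3] :: real^3)) (snd (vector [0, 0, 1] :: real^3, vector [1, 2 * real k + 1, 3]))"
      by (simp add: axis_plane_def mem_box_vector)
    then show "axis_plane 3 2 \<inter> box (fst b) (snd b) \<inter>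
        box (fst (vector [0, 0, 1], vector [1, 2 * real k + 1, 3] :: real^3)) (snd (vector [0, 0, 1] :: real^3, vector [1, 2 * real k + 1, 3])) \<noteq> {}"
      by blast
  qed
  ultimately show ?thesis using assms unfolding slab_patches_def by auto
qed

lemma arm_patch_connected:
  assumes "p \<in> arm_patches j"
  shows "connected (patch p)"
proof -
  have "connected (patch (i, c, [b]))" for i c b by (rule connected_patch) simp
  moreover have "connected (patch (i, c, [b, b']))"
    if "q \<in> axis_plane i c \<inter> box (fst b') (snd b') \<inter> box (fst b) (snd b)" for i c b b' q
    using that by (intro connected_patch) auto
  note this[where q = "vector [5 / 2, 2 * real j + 1, 3 / 2]", of 2 "2 * real j + 1"
       "(vector [2, 2 * real j, 1], vector [3, 2 * real j + 2, 3])"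
       "(vector [1, 2 * real j, 1], vector [3, 2 * real j + 2, 2])"]
    and this[where q = "vector [5 / 2, 2 * real j + 2, 3 / 2]", of 2 "2 * real j + 2"
       "(vector [2, 2 * real j + 1, 1], vector [3, 2 * real j + 3, 3])"
       "(vector [1, 2 * real j + 1, 1], vector [3, 2 * real j + 3, 2])"]
  ultimately show ?thesis using assms unfolding arm_patches_def
    by (auto simp: axis_plane_def mem_box_vector)
qed

definition rack_patches :: "nat \<Rightarrow> (3 \<times> real \<times> ((real^3) \<times> (real^3)) list) set" where
  "rack_patches k = slab_patches k \<union> (\<Union>j<k. arm_patches j)"

lemma card_rack_patches: "finite (rack_patches k)" "card (rack_patches k) \<le> 6 * k + 6"
proof -
  have s: "card (slab_patches k) \<le> 6" "card (arm_patches j) \<le> 6" for j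
    unfolding slab_patches_def arm_patches_def by (rule card_le_6)+
  show "finite (rack_patches k)"
    unfolding rack_patches_def slab_patches_def arm_patches_def by auto
  have "card (\<Union>j<k. arm_patches j) \<le> (\<Sum>j<k. card (arm_patches j))" by (rule card_UN_le) simp
  also have "\<dots> \<le> (\<Sum>j<k. 6)" by (intro sum_mono s)
  finally have "card (\<Union>j<k. arm_patches j) \<le> 6 * k" by simp
  then show "card (rack_patches k) \<le> 6 * k + 6"
    unfolding rack_patches_def using card_Un_le[of "slab_patches k" "\<Union>j<k. arm_patches j"] s(1) by linarith
qed

text \<open>Genericity puts all coordinates but the \<open>i\<close>-th strictly between the bounds
  of a box containing \<open>x\<close>. Since \<open>x\<close> is in no open box, its
  \<open>i\<close>-th coordinate is a bound, and this names the patch. The range up to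
  \<open>2 * k + 3\<close> covers all bounds, including 3 when \<open>k = 0\<close>.\<close>

lemma generic_frontier_in_patch:
  assumes x: "x \<in> frontier (rack k)" and gen: "\<And>j n. j \<noteq> i \<Longrightarrow> n \<le> 2 * k + 3 \<Longrightarrow> x $ j \<noteq> real n"
  obtains p where "p \<in> rack_patches k" "x \<in> patch p" "patch_plane p = axis_plane i (x $ i)"
proof -
  have "closed (rack k)" unfolding rack_def rack_boxes_def by auto
  then have xP: "x \<in> rack k" and xI: "x \<notin> interior (rack k)"
    using x frontier_subset_closed by (auto simp: frontier_def)
  have nint: "\<not> (0 < x $ 1 \<and> x $ 1 < 1 \<and> 0 < x $ 2 \<and> x $ 2 < 2 * real k + 1 \<and> 0 < x $ 3 \<and> x $ 3 < 2)"
    "j < k \<Longrightarrow> \<not> (0 < x $ 1 \<and> x $ 1 < 3 \<and> 2 * real j + 1 < x $ 2 \<and> x $ 2 < 2 * real j + 2 \<and> 1 < x $ 3 \<and> x $ 3 < 2)"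
    "j < k \<Longrightarrow> \<not> (2 < x $ 1 \<and> x $ 1 < 3 \<and> 2 * real j + 1 < x $ 2 \<and> x $ 2 < 2 * real j + 2 \<and> 1 < x $ 3 \<and> x $ 3 < 3)"
    for j
    using xI interior_rack_slab interior_rack_arm interior_rack_post by blast+
  have neq: "x $ j \<noteq> 0 \<and> x $ j \<noteq> 1 \<and> x $ j \<noteq> 2 \<and> x $ j \<noteq> 3" if "j \<noteq> i" for j
    using gen[OF that, of 0] gen[OF that, of 1] gen[OF that, of 2] gen[OF that, of 3] by auto
  have neq': "x $ j \<noteq> 2 * real m + 1 \<and> x $ j \<noteq> 2 * real m + 2" if "j \<noteq> i" "m \<le> k" for j m
    using gen[OF that(1), of "2 * m + 1"] gen[OF that(1), of "2 * m + 2"] that(2) by auto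
  note defs = mem_patch mem_box_vector patch_plane_def index_3_neq
  let ?thesis' = "\<exists>p\<in>rack_patches k. x \<in> patch p \<and> patch_plane p = axis_plane i (x $ i)"
  have slabI: ?thesis' if "p \<in> slab_patches k" "x \<in> patch p" "patch_plane p = axis_plane i (x $ i)" for p
    using that unfolding rack_patches_def by blast
  have armI: ?thesis' if "j < k" "p \<in> arm_patches j" "x \<in> patch p" "patch_plane p = axis_plane i (x $ i)" for p j
    using that unfolding rack_patches_def by blast
  consider "i = 1" | "i = 2" | "i = 3" by (metis exhaust_3)
  then have ?thesis'
  proof cases
    case 1
    have n: "x $ 2 \<noteq> 0" "x $ 3 \<noteq> 0" "x $ 3 \<noteq> 1" "x $ 3 \<noteq> 2" "x $ 3 \<noteq> 3"
      "m \<le> k \<Longrightarrow> x $ 2 \<noteq> 2 * real m + 1" "m \<le> k \<Longrightarrow> x $ 2 \<noteq> 2 * real m + 2" for m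
      using neq[of 2] neq[of 3] neq'[of 2 m] 1 by auto
    from xP show ?thesis'
    proof (cases rule: mem_rackE)
      case slab
      have s: "0 < x $ 2" "x $ 2 < 2 * real k + 1" "0 < x $ 3" "x $ 3 < 2"
        using slab n(1-5) n(6)[of k] by auto
      then have "x $ 1 = 0 \<or> x $ 1 = 1" using nint(1) slab by force
      then consider "x $ 1 = 0" | "x $ 1 = 1" "x $ 3 < 1" | "x $ 1 = 1" "1 < x $ 3" using n(3) by fastforce
      then show ?thesis'
      proof cases
        case 1
        then show ?thesis' using s \<open>i = 1\<close>
          by (intro slabI[of "(1, 0, [(vector [-1, 0, 0], vector [1, 2 * real k + 1, 2])])"])
            (auto simp: defs slab_patches_def)
      next
        case 2
        then show ?thesis' using s \<open>i = 1\<close>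
          by (intro slabI[of "(1, 1, (vector [0, 0, 0], vector [2, 2 * real k + 1, 1]) #
              map (\<lambda>j. (vector [0, 2 * real j, 0], vector [2, 2 * real j + 1, 2])) [0..<Suc k])"])
            (auto simp: defs slab_patches_def simp del: upt_Suc)
      next
        case 3
        \<comment> \<open>\<open>2 * j\<close> is the largest even integer not above the second
          coordinate. Beyond \<open>2 * j + 1\<close> the point would be interior to arm
          \<open>j\<close>, so it lies in a gap.\<close>
        define j where "j = nat \<lfloor>x $ 2 / 2\<rfloor>"
        have "real j = of_int \<lfloor>x $ 2 / 2\<rfloor>" using s unfolding j_def by simp
        then have j: "2 * real j \<le> x $ 2" "x $ 2 < 2 * real j + 2" by linarith+
        then have jk: "j \<le> k" using s(2) by linarith
        then have "x $ 2 \<noteq> real (2 * j)" using gen[of 2 "2 * j"] \<open>i = 1\<close> by simp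
        then have lo: "2 * real j < x $ 2" using j by simp
        have "x $ 2 < 2 * real j + 1"
        proof (rule ccontr)
          assume "\<not> x $ 2 < 2 * real j + 1"
          then have "2 * real j + 1 < x $ 2" using n(6)[OF jk] by simp
          moreover from this have "j < k" using jk s(2) by (cases "j = k") auto
          ultimately show False using nint(2)[of j] j 3 s by auto
        qed
        then have xp: "x \<in> patch (1, 1, (vector [0, 0, 0], vector [2, 2 * real k + 1, 1]) #
              map (\<lambda>j. (vector [0, 2 * real j, 0], vector [2, 2 * real j + 1, 2])) [0..<Suc k])"
          using 3 s lo jk by (auto simp: defs less_Suc_eq_le simp del: upt_Suc)
        show ?thesis'
          by (rule slabI[OF _ xp]) (use 3 \<open>i = 1\<close> in \<open>auto simp: patch_plane_def slab_patches_def simp del: upt_Suc\<close>)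
      qed
    next
      case (arm j)
      have jk: "real j + 1 \<le> real k" using arm(1) by simp
      have s: "2 * real j + 1 < x $ 2" "x $ 2 < 2 * real j + 2" "1 < x $ 3" "x $ 3 < 2"
        using arm n(1-5) n(6,7)[of j] by auto
      then have "x $ 1 = 0 \<or> x $ 1 = 3" using nint(2)[OF arm(1)] arm by force
      then show ?thesis'
      proof
        assume "x $ 1 = 0"
        then show ?thesis' using s \<open>i = 1\<close> jk
          by (intro slabI[of "(1, 0, [(vector [-1, 0, 0], vector [1, 2 * real k + 1, 2])])"])
            (auto simp: defs slab_patches_def)
      next
        assume "x $ 1 = 3"
        then show ?thesis' using s \<open>i = 1\<close>
          by (intro armI[OF arm(1), of "(1, 3, [(vector [2, 2 * real j + 1, 1], vector [4, 2 * real j + 2, 3])])"])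
            (auto simp: defs arm_patches_def)
      qed
    next
      case (post j)
      have s: "2 * real j + 1 < x $ 2" "x $ 2 < 2 * real j + 2" "1 < x $ 3" "x $ 3 < 3"
        using post n(1-5) n(6,7)[of j] by auto
      then have "x $ 1 = 2 \<or> x $ 1 = 3" using nint(3)[OF post(1)] post by force
      then show ?thesis'
      proof
        assume x1: "x $ 1 = 2"
        then have "2 < x $ 3" using nint(2)[OF post(1)] s n(4) by force
        then show ?thesis' using s \<open>i = 1\<close> x1
          by (intro armI[OF post(1), of "(1, 2, [(vector [1, 2 * real j + 1, 2], vector [3, 2 * real j + 2, 3])])"])
            (auto simp: defs arm_patches_def)
      next
        assume "x $ 1 = 3"
        then show ?thesis' using s \<open>i = 1\<close>
          by (intro armI[OF post(1), of "(1, 3, [(vector [2, 2 * real j + 1, 1], vector [4, 2 * real j + 2, 3])])"])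
            (auto simp: defs arm_patches_def)
      qed
    qed
  next
    case 2
    have n: "x $ 1 \<noteq> 0" "x $ 1 \<noteq> 1" "x $ 1 \<noteq> 2" "x $ 1 \<noteq> 3" "x $ 3 \<noteq> 0" "x $ 3 \<noteq> 1" "x $ 3 \<noteq> 2" "x $ 3 \<noteq> 3"
      using neq[of 1] neq[of 3] 2 by auto
    have side: ?thesis' if j: "j < k" and x2: "x $ 2 = 2 * real j + 1 \<or> x $ 2 = 2 * real j + 2"
      and s: "1 < x $ 1" "x $ 1 < 3" "1 < x $ 3" "x $ 3 < 3" "x $ 3 < 2 \<or> 2 < x $ 1" for j
      using x2
    proof
      assume "x $ 2 = 2 * real j + 1"
      then show ?thesis' using s \<open>i = 2\<close>
        by (intro armI[OF j, of "(2, 2 * real j + 1, [(vector [1, 2 * real j, 1], vector [3, 2 * real j + 2, 2]),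
              (vector [2, 2 * real j, 1], vector [3, 2 * real j + 2, 3])])"])
          (auto simp: defs arm_patches_def)
    next
      assume "x $ 2 = 2 * real j + 2"
      then show ?thesis' using s \<open>i = 2\<close>
        by (intro armI[OF j, of "(2, 2 * real j + 2, [(vector [1, 2 * real j + 1, 1], vector [3, 2 * real j + 3, 2]),
              (vector [2, 2 * real j + 1, 1], vector [3, 2 * real j + 3, 3])])"])
          (auto simp: defs arm_patches_def)
    qed
    from xP show ?thesis'
    proof (cases rule: mem_rackE)
      case slab
      have s: "0 < x $ 1" "x $ 1 < 1" "0 < x $ 3" "x $ 3 < 2" using slab n by auto
      then have "x $ 2 = 0 \<or> x $ 2 = 2 * real k + 1" using nint(1) slab by force
      then show ?thesis'
      proof
        assume "x $ 2 = 0"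
        then show ?thesis' using s \<open>i = 2\<close>
          by (intro slabI[of "(2, 0, [(vector [0, -1, 0], vector [1, 1, 2])])"])
            (auto simp: defs slab_patches_def)
      next
        assume "x $ 2 = 2 * real k + 1"
        then show ?thesis' using s \<open>i = 2\<close>
          by (intro slabI[of "(2, 2 * real k + 1, [(vector [0, 0, 0], vector [1, 2 * real k + 2, 2])])"])
            (auto simp: defs slab_patches_def)
      qed
    next
      case (arm j)
      have jk: "real j + 1 \<le> real k" using arm(1) by simp
      have s: "0 < x $ 1" "x $ 1 < 3" "1 < x $ 3" "x $ 3 < 2" using arm n by auto
      then have x2: "x $ 2 = 2 * real j + 1 \<or> x $ 2 = 2 * real j + 2"
        using nint(2)[OF arm(1)] arm by force
      \<comment> \<open>Further left such a point would be interior to the slab.\<close>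
      have "1 < x $ 1"
      proof (rule ccontr)
        assume "\<not> 1 < x $ 1"
        then show False using nint(1) s x2 n(2) jk by force
      qed
      then show ?thesis' using side[OF arm(1) x2] s by auto
    next
      case (post j)
      have s: "2 < x $ 1" "x $ 1 < 3" "1 < x $ 3" "x $ 3 < 3" using post n by auto
      then have "x $ 2 = 2 * real j + 1 \<or> x $ 2 = 2 * real j + 2"
        using nint(3)[OF post(1)] post by force
      then show ?thesis' using side[OF post(1)] s by auto
    qed
  next
    case 3
    have n: "x $ 1 \<noteq> 0" "x $ 1 \<noteq> 1" "x $ 1 \<noteq> 2" "x $ 1 \<noteq> 3" "x $ 2 \<noteq> 0"
      "m \<le> k \<Longrightarrow> x $ 2 \<noteq> 2 * real m + 1" "m \<le> k \<Longrightarrow> x $ 2 \<noteq> 2 * real m + 2" for m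
      using neq[of 1] neq[of 2] neq'[of 2 m] 3 by auto
    have bottom: ?thesis' if "j < k" "x $ 3 = 1" "1 < x $ 1" "x $ 1 < 3" "2 * real j + 1 < x $ 2" "x $ 2 < 2 * real j + 2" for j
      using that \<open>i = 3\<close>
      by (intro armI[OF that(1), of "(3, 1, [(vector [1, 2 * real j + 1, 0], vector [3, 2 * real j + 2, 2])])"])
        (auto simp: defs arm_patches_def)
    have top: ?thesis' if "x \<in> patch (3, 2, (vector [0, 0, 1], vector [1, 2 * real k + 1, 3]) #
        map (\<lambda>j. (vector [0, 2 * real j + 1, 1], vector [2, 2 * real j + 2, 3])) [0..<k])"
      by (rule slabI[OF _ that]) (use that \<open>i = 3\<close> in \<open>auto simp: defs slab_patches_def\<close>)
    from xP show ?thesis'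
    proof (cases rule: mem_rackE)
      case slab
      have s: "0 < x $ 1" "x $ 1 < 1" "0 < x $ 2" "x $ 2 < 2 * real k + 1"
        using slab n(1-5) n(6)[of k] by auto
      then have "x $ 3 = 0 \<or> x $ 3 = 2" using nint(1) slab by force
      then show ?thesis'
      proof
        assume "x $ 3 = 0"
        then show ?thesis' using s \<open>i = 3\<close>
          by (intro slabI[of "(3, 0, [(vector [0, 0, -1], vector [1, 2 * real k + 1, 1])])"])
            (auto simp: defs slab_patches_def)
      next
        assume "x $ 3 = 2"
        then show ?thesis' using s by (intro top) (auto simp: defs)
      qed
    next
      case (arm j)
      have jk: "real j + 1 \<le> real k" using arm(1) by simp
      have s: "0 < x $ 1" "x $ 1 < 3" "2 * real j + 1 < x $ 2" "x $ 2 < 2 * real j + 2"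
        using arm n(1-5) n(6,7)[of j] by auto
      then have "x $ 3 = 1 \<or> x $ 3 = 2" using nint(2)[OF arm(1)] arm by force
      then show ?thesis'
      proof
        assume x3: "x $ 3 = 1"
        have "1 < x $ 1"
        proof (rule ccontr)
          assume "\<not> 1 < x $ 1"
          then show False using nint(1) s x3 n(2) jk by force
        qed
        then show ?thesis' using bottom[OF arm(1) x3] s by auto
      next
        assume x3: "x $ 3 = 2"
        \<comment> \<open>Further right a point at height 2 would be interior to the post.\<close>
        have "x $ 1 < 2"
        proof (rule ccontr)
          assume "\<not> x $ 1 < 2"
          then show False using nint(3)[OF arm(1)] s x3 n(3) by force
        qed
        then show ?thesis' using s x3 arm(1) by (intro top) (auto simp: defs)
      qed
    next
      case (post j)
      have s: "2 < x $ 1" "x $ 1 < 3" "2 * real j + 1 < x $ 2" "x $ 2 < 2 * real j + 2"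
        using post n(1-5) n(6,7)[of j] by auto
      then have "x $ 3 = 1 \<or> x $ 3 = 3" using nint(3)[OF post(1)] post by force
      then show ?thesis'
      proof
        assume "x $ 3 = 1"
        then show ?thesis' using bottom[OF post(1)] s by auto
      next
        assume "x $ 3 = 3"
        then show ?thesis' using s \<open>i = 3\<close>
          by (intro armI[OF post(1), of "(3, 3, [(vector [2, 2 * real j + 1, 2], vector [3, 2 * real j + 2, 4])])"])
            (auto simp: defs arm_patches_def)
      qed
    qed
  qed
  then show ?thesis using that by blast
qed

lemma card_faces_rack: "card (faces (rack k)) \<le> 6 * k + 6"
proof -
  let ?C = "real ` {..2 * k + 3}"
  have orth: "orthogonal_polyhedron (rack k)" by (rule rack_orthogonal_polyhedron)
  have "card (faces (rack k)) \<le> card (rack_patches k)"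
  proof (rule faces_card_le(2)[where H = patch_plane and W = patch])
    show "finite (rack_patches k)" by (rule card_rack_patches)
    show "openin (top_of_set (patch_plane p)) (patch p) \<and> patch p \<subseteq> frontier (rack k) \<and> connected (patch p)"
      if "p \<in> rack_patches k" for p
      using that openin_patch slab_patch_frontier arm_patch_frontier slab_patch_connected arm_patch_connected
      unfolding rack_patches_def by blast
    fix F assume F: "F \<in> faces (rack k)"
    then obtain i c where ic: "F \<subseteq> axis_plane i c"
      using orth unfolding orthogonal_polyhedron_def axis_plane_def by blast
    obtain x where x: "x \<in> rel_interior F" "\<And>j. j \<noteq> i \<Longrightarrow> x $ j \<notin> ?C"
      using face_generic_point[of ?C F "rack k" i c] F ic by auto
    have "x \<in> frontier (rack k)" "x $ i = c"
      using x(1) faceD(1)[OF F] ic rel_interior_subset unfolding axis_plane_def by blast+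
    moreover have "x $ j \<noteq> real n" if "j \<noteq> i" "n \<le> 2 * k + 3" for j n
      using x(2)[OF that(1)] that(2) by auto
    ultimately obtain p where "p \<in> rack_patches k" "x \<in> patch p" "patch_plane p = axis_plane i c"
      using generic_frontier_in_patch[of x k i] by metis
    then show "\<exists>p\<in>rack_patches k. affine hull F = patch_plane p \<and> rel_interior F \<inter> patch p \<noteq> {}"
      using face_affine_hull[OF F ic] x(1) by auto
  qed
  then show ?thesis using card_rack_patches(2)[of k] by linarith
qed

section \<open>Visibility in the rack and the lower bound\<close>

text \<open>A connected set of reals is an interval, so leaving the range of arm \<open>j\<close>
  would take it through an adjacent gap.\<close>

lemma connected_in_arm:
  fixes T :: "real set"
  assumes T: "connected T" "\<And>y. y \<in> T \<Longrightarrow> \<exists>j<k. 2 * real j + 1 \<le> y \<and> y \<le> 2 * real j + 2"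
    and y: "y \<in> T" "2 * real j + 1 \<le> y" "y \<le> 2 * real j + 2" and z: "z \<in> T"
  shows "2 * real j + 1 \<le> z \<and> z \<le> 2 * real j + 2"
proof (rule ccontr)
  have gap: "w \<notin> T" if "2 * real m < w" "w < 2 * real m + 1" for w m
    using T(2)[of w] between_arms[OF that] by blast
  have btw: "w \<in> T" if "u \<in> T" "v \<in> T" "u \<le> w" "w \<le> v" for u v w
    using T(1) that unfolding is_interval_connected_1[symmetric] is_interval_1 by blast
  assume "\<not> (2 * real j + 1 \<le> z \<and> z \<le> 2 * real j + 2)"
  then consider "z < 2 * real j + 1" | "z > 2 * real j + 2" by linarith
  then show False
  proof cases
    case 1
    \<comment> \<open>Cut off at the middle of the gap, \<open>z\<close> becomes a point of
      \<open>T\<close> inside the gap.\<close>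
    then have "max z (2 * real j + 1 / 2) \<in> T" using y by (intro btw[OF z y(1)]) auto
    then show False using gap[of j "max z (2 * real j + 1 / 2)"] 1 by auto
  next
    case 2
    then have "min z (2 * real j + 5 / 2) \<in> T" using y by (intro btw[OF y(1) z]) auto
    then show False using gap[of "j + 1" "min z (2 * real j + 5 / 2)"] 2 by auto
  qed
qed

lemma rack_right_in_arm:
  assumes "p \<in> rack k" "1 < p $ 1"
  shows "\<exists>j<k. 2 * real j + 1 \<le> p $ 2 \<and> p $ 2 \<le> 2 * real j + 2"
  using assms by (auto simp: mem_rack)

text \<open>Above height 2 the rack has nothing to the left of \<open>q\<close>, so no sight line
  from \<open>q\<close> goes left; along one that does not, the second coordinate is confined to the
  ranges of the arms.\<close>

lemma visible_from_top:
  assumes vis: "visible (rack k) q s" and q: "q $ 1 = 2" "q $ 2 = 2 * real j + 1" "q $ 3 = 3"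
  shows "2 \<le> s $ 1" "2 * real j + 1 \<le> s $ 2" "s $ 2 \<le> 2 * real j + 2"
proof -
  have seg: "(1 - u) *\<^sub>R q + u *\<^sub>R s \<in> rack k" if "0 \<le> u" "u \<le> 1" for u
    using vis that unfolding visible_def in_segment(1) subset_iff by blast
  have sP: "s \<in> rack k" using seg[of 1] by simp
  show s1: "2 \<le> s $ 1"
  proof (rule ccontr)
    assume "\<not> 2 \<le> s $ 1"
    moreover have "0 \<le> s $ 3" using sP by (auto simp: mem_rack)
    \<comment> \<open>A quarter of the way from height 3 towards \<open>s $ 3 \<ge> 0\<close> the
      height is at least 9/4, above slab and arms, while the point is already left of all
      posts.\<close>
    moreover have "(1 - 1 / 4) *\<^sub>R q + (1 / 4) *\<^sub>R s \<in> rack k" by (rule seg) auto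
    ultimately show False using q by (auto simp: mem_rack)
  qed
  let ?T = "(\<lambda>p. p $ 2) ` closed_segment q s"
  have "connected ?T" by (intro connected_continuous_image continuous_intros) auto
  moreover have "\<exists>j<k. 2 * real j + 1 \<le> y \<and> y \<le> 2 * real j + 2" if "y \<in> ?T" for y
  proof -
    obtain p where p: "p \<in> closed_segment q s" "y = p $ 2" using \<open>y \<in> ?T\<close> by auto
    then obtain u where u: "0 \<le> u" "u \<le> 1" "p = (1 - u) *\<^sub>R q + u *\<^sub>R s" by (auto simp: in_segment)
    have "p $ 1 = 2 + u * (s $ 1 - 2)" unfolding u(3) using q by (simp add: algebra_simps)
    then have "1 < p $ 1" using s1 u(1) by (simp add: add_strict_increasing)
    then show ?thesis using rack_right_in_arm[of p k] seg[OF u(1,2)] p(2) unfolding u(3) by blast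
  qed
  moreover have "q $ 2 \<in> ?T" "s $ 2 \<in> ?T" by auto
  ultimately have "2 * real j + 1 \<le> s $ 2 \<and> s $ 2 \<le> 2 * real j + 2"
    using connected_in_arm[of ?T k "q $ 2" j "s $ 2"] q(2) by auto
  then show "2 * real j + 1 \<le> s $ 2" "s $ 2 \<le> 2 * real j + 2" by auto
qed

text \<open>Below height 1 the rack ends at the right side of the slab. A quarter of the way from
  height 0 towards \<open>s $ 3 \<le> 3\<close> the height is at most 3/4, so a line heading right
  has left the rack.\<close>

lemma visible_from_corner:
  assumes vis: "visible (rack k) q s" and q: "q $ 1 = 1" "q $ 2 = 0" "q $ 3 = 0"
  shows "s $ 1 \<le> 1"
proof (rule ccontr)
  have seg: "(1 - u) *\<^sub>R q + u *\<^sub>R s \<in> rack k" if "0 \<le> u" "u \<le> 1" for u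
    using vis that unfolding visible_def in_segment(1) subset_iff by blast
  assume "\<not> s $ 1 \<le> 1"
  moreover have "s $ 3 \<le> 3" using seg[of 1] by (auto simp: mem_rack)
  moreover have "(1 - 1 / 4) *\<^sub>R q + (1 / 4) *\<^sub>R s \<in> rack k" by (rule seg) auto
  ultimately show False using q by (auto simp: mem_rack)
qed

text \<open>The relative interior is open in its plane. The purpose is to push a face point into an
  open box of the rack, which is impossible for a boundary point.\<close>

lemma face_push:
  assumes F: "F \<in> faces P" "F \<subseteq> axis_plane i c" and s: "s \<in> rel_interior F" and q: "q $ i = c"
  obtains u where "0 < u" "u < 1" "(1 - u) *\<^sub>R s + u *\<^sub>R q \<in> rel_interior F"
proof -
  obtain e where e: "e > 0" "ball s e \<inter> axis_plane i c \<subseteq> rel_interior F"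
    using openin_rel_interior[of F] s unfolding face_affine_hull[OF F] openin_contains_ball by blast
  have "((\<lambda>u. (1 - u) *\<^sub>R s + u *\<^sub>R q) \<longlongrightarrow> (1 - 0) *\<^sub>R s + 0 *\<^sub>R q) (at_right 0)"
    by (intro tendsto_intros)
  then have "((\<lambda>u. (1 - u) *\<^sub>R s + u *\<^sub>R q) \<longlongrightarrow> s) (at_right 0)" by simp
  then have "\<forall>\<^sub>F u in at_right 0. (1 - u) *\<^sub>R s + u *\<^sub>R q \<in> ball s e"
    by (rule topological_tendstoD) (use e in auto)
  moreover have "\<forall>\<^sub>F u in at_right 0. u < (1::real)"
    unfolding eventually_at_right[OF zero_less_one] using zero_less_one by blast
  moreover have "\<forall>\<^sub>F u in at_right 0. 0 < (u::real)" by (rule eventually_at_right_less)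
  ultimately have "\<forall>\<^sub>F u in at_right 0. (1 - u) *\<^sub>R s + u *\<^sub>R q \<in> ball s e \<and> u < 1 \<and> 0 < u"
    by eventually_elim auto
  then obtain u :: real where u: "(1 - u) *\<^sub>R s + u *\<^sub>R q \<in> ball s e" "u < 1" "0 < u"
    using eventually_happens'[OF trivial_limit_at_right_real] by blast
  have "s $ i = c" using s F(2) rel_interior_subset unfolding axis_plane_def by blast
  then have "(1 - u) *\<^sub>R s + u *\<^sub>R q \<in> axis_plane i c"
    using q by (simp add: axis_plane_def algebra_simps)
  then show ?thesis using that u e(2) by blast
qed

lemma strict_convex_comb:
  fixes a b s t u :: real
  assumes "a \<le> s" "s \<le> b" "a < t" "t < b" "0 < u" "u < 1"
  shows "a < (1 - u) * s + u * t" "(1 - u) * s + u * t < b"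
proof -
  have "(1 - u) * a \<le> (1 - u) * s" "(1 - u) * s \<le> (1 - u) * b" "u * a < u * t" "u * t < u * b"
    using assms by (auto intro!: mult_left_mono mult_strict_left_mono)
  then show "a < (1 - u) * s + u * t" "(1 - u) * s + u * t < b" by (auto simp: algebra_simps)
qed

text \<open>A plane orthogonal to axis 1 cannot reach both regions, and any other axis plane doing
  so cuts through the open slab or the open post. A point of the face pushed within the plane
  towards that open box becomes interior, yet the face lies in the boundary.\<close>

lemma no_face_slab_post:
  assumes F: "F \<in> faces (rack k)" and s: "s \<in> rel_interior F" "s $ 1 \<le> 1" and t: "t \<in> rel_interior F" "2 \<le> t $ 1"
  shows False
proof -
  have FP: "rel_interior F \<subseteq> frontier (rack k)" using faceD(1)[OF F] rel_interior_subset by blast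
  obtain i c where ic: "F \<subseteq> axis_plane i c"
    using F rack_orthogonal_polyhedron unfolding orthogonal_polyhedron_def axis_plane_def by blast
  have c: "s $ i = c" "t $ i = c" using s t ic rel_interior_subset unfolding axis_plane_def by blast+
  have cl: "closed (rack k)" unfolding rack_def rack_boxes_def by auto
  have nint: "x \<notin> interior (rack k)" if "x \<in> rel_interior F" for x using FP that by (auto simp: frontier_def)
  have "s \<in> rack k" "t \<in> rack k" using s t FP frontier_subset_closed[OF cl] by blast+
  then obtain j where j: "j < k" "2 * real j + 1 \<le> t $ 2" "t $ 2 \<le> 2 * real j + 2" "1 \<le> t $ 3" "t $ 3 \<le> 3" "t $ 1 \<le> 3"
    using t by (auto simp: mem_rack)
  have jk: "real j + 1 \<le> real k" using j by simp
  have sA: "0 \<le> s $ 1" "0 \<le> s $ 2" "s $ 2 \<le> 2 * real k + 1" "0 \<le> s $ 3" "s $ 3 \<le> 2"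
  proof -
    have "real m + 1 \<le> real k" if "m < k" for m using that by simp
    then show "0 \<le> s $ 1" "0 \<le> s $ 2" "s $ 2 \<le> 2 * real k + 1" "0 \<le> s $ 3" "s $ 3 \<le> 2"
      using \<open>s \<in> rack k\<close> s(2) by (fastforce simp: mem_rack)+
  qed
  have toslab: False if q: "q $ i = c" "q $ 1 = 1 / 2" "0 < q $ 2" "q $ 2 < 2 * real k + 1" "0 < q $ 3" "q $ 3 < 2" for q
  proof -
    obtain u where u: "0 < u" "u < 1" "(1 - u) *\<^sub>R s + u *\<^sub>R q \<in> rel_interior F"
      using face_push[OF F ic s(1) q(1)] by blast
    have "(1 - u) *\<^sub>R s + u *\<^sub>R q \<in> interior (rack k)"
      by (rule interior_rack_slab) (use strict_convex_comb[OF _ _ _ _ u(1,2)] sA s q in auto)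
    then show False using nint u(3) by blast
  qed
  consider "i = 1" | "i = 2" | "i = 3" by (metis exhaust_3)
  then show False
  proof cases
    case 1
    then show False using c s t by auto
  next
    case 2
    show False
      by (rule toslab[of "vector [1 / 2, c, 1]"]) (use 2 c j jk in auto)
  next
    case 3
    show False
    proof (cases "c < 2")
      case True
      show False
        by (rule toslab[of "vector [1 / 2, 1 / 2, c]"]) (use 3 c j sA True in auto)
    next
      case False
      \<comment> \<open>At height 2 the plane only grazes the slab but cuts post \<open>j\<close>
        halfway up, so \<open>t\<close> is pushed instead of \<open>s\<close>.\<close>
      then have c2: "c = 2" using 3 c sA by auto
      let ?q = "vector [5 / 2, 2 * real j + 3 / 2, 2] :: real^3"
      obtain u where u: "0 < u" "u < 1" "(1 - u) *\<^sub>R t + u *\<^sub>R ?q \<in> rel_interior F"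
        using face_push[OF F ic t(1), of ?q] 3 c2 by auto
      have "t $ 3 = 2" using 3 c c2 by auto
      then have "(1 - u) *\<^sub>R t + u *\<^sub>R ?q \<in> interior (rack k)"
        by (intro interior_rack_post[OF j(1)])
          (use strict_convex_comb[OF _ _ _ _ u(1,2), of 2 "t $ 1" 3 "5 / 2"]
            strict_convex_comb[OF _ _ _ _ u(1,2), of "2 * real j + 1" "t $ 2" "2 * real j + 2" "2 * real j + 3 / 2"]
            strict_convex_comb[OF _ _ _ _ u(1,2), of 1 "t $ 3" 3 2] j t u in auto)
      then show False using nint u(3) by blast
    qed
  qed
qed

text \<open>The bottom right corner of the slab is only seen from the slab, and a top left corner of a post only
  from that post; no face reaches two of these regions.\<close>

lemma rack_guards:
  assumes G: "finite G" "guarded_by_open_faces (rack k) G"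
  shows "k + 1 \<le> card G"
proof -
  \<comment> \<open>Index \<open>k\<close> stands for the corner of the slab, smaller indices for
    the corners of the posts.\<close>
  define q :: "nat \<Rightarrow> real^3" where "q j = (if j = k then vector [1, 0, 0] else vector [2, 2 * real j + 1, 3])" for j
  have "q j \<in> rack k" if "j \<le> k" for j
    using that by (cases "j = k") (auto simp: q_def mem_rack intro!: exI[of _ j])
  then have "\<exists>F s. F \<in> G \<and> s \<in> rel_interior F \<and> visible (rack k) (q j) s" if "j \<le> k" for j
    using G(2) that unfolding guarded_by_open_faces_def guards_def by fastforce
  then obtain F s where Fs: "\<And>j. j \<le> k \<Longrightarrow> F j \<in> G \<and> s j \<in> rel_interior (F j) \<and> visible (rack k) (q j) (s j)"
    by metis
  have top: "2 \<le> s j $ 1 \<and> 2 * real j + 1 \<le> s j $ 2 \<and> s j $ 2 \<le> 2 * real j + 2" if "j < k" for j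
    using visible_from_top[of k "q j" "s j" j] Fs[of j] that by (auto simp: q_def)
  have corner: "s k $ 1 \<le> 1"
    using visible_from_corner[of k "q k" "s k"] Fs[of k] by (auto simp: q_def)
  have GF: "F j \<in> faces (rack k)" if "j \<le> k" for j
    using Fs[OF that] G(2) unfolding guarded_by_open_faces_def by blast
  have cl: "closed (rack k)" unfolding rack_def rack_boxes_def by auto
  have nk: "F j \<noteq> F k" if "j < k" for j
    using no_face_slab_post[OF GF[of k], of "s k" "s j"] corner top[OF that] Fs[of k] Fs[of j] that by auto
  have nj: "j = m" if jm: "j < k" "m < k" "F j = F m" for j m
  proof -
    let ?R = "rel_interior (F j)"
    have sj: "s j \<in> ?R" "s m \<in> ?R" using Fs[of j] Fs[of m] jm by auto
    \<comment> \<open>As \<open>F j\<close> reaches a post, its relative interior stays to the right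
      of the slab. There its second coordinates form a connected set within the arm ranges, which
      cannot pass from arm \<open>j\<close> to arm \<open>m\<close>.\<close>
    have "1 < p $ 1" if "p \<in> ?R" for p
      using no_face_slab_post[OF GF[of j] that _ sj(1)] top[OF jm(1)] jm(1) by fastforce
    moreover have "?R \<subseteq> rack k"
      using faceD(1)[OF GF[of j]] jm(1) rel_interior_subset[of "F j"] frontier_subset_closed[OF cl] by fastforce
    ultimately have "\<exists>j<k. 2 * real j + 1 \<le> y \<and> y \<le> 2 * real j + 2" if "y \<in> (\<lambda>p. p $ 2) ` ?R" for y
      using rack_right_in_arm that by blast
    moreover have "connected ((\<lambda>p. p $ 2) ` ?R)"
      using faceD(4)[OF GF[of j]] jm(1) by (intro connected_continuous_image continuous_intros) auto
    ultimately have "2 * real j + 1 \<le> s m $ 2 \<and> s m $ 2 \<le> 2 * real j + 2"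
      using connected_in_arm[of "(\<lambda>p. p $ 2) ` ?R" k "s j $ 2" j "s m $ 2"] sj top[OF jm(1)] by blast
    then have "real j < real (m + 1)" "real m < real (j + 1)" using top[OF jm(2)] by auto
    then show "j = m" by (simp only: of_nat_less_iff)
  qed
  have "inj_on F {..k}"
    using nk nj by (intro inj_onI) (metis atMost_iff order_le_less)
  then have "card {..k} \<le> card G" using Fs G(1) by (intro card_inj_on_le) auto
  then show ?thesis by simp
qed

theorem theorem2:
  shows "(\<forall>P. orthogonal_polyhedron P \<longrightarrow>
            (\<exists>G. finite G \<and> card G \<le> card (faces P) div 6 \<and> guarded_by_open_faces P G))
       \<and> (\<forall>N::nat. \<exists>P. orthogonal_polyhedron P \<and> N \<le> card (faces P) \<and>
            (\<forall>G. finite G \<and> guarded_by_open_faces P G \<longrightarrow> card (faces P) div 6 \<le> card G))"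
proof (intro conjI allI impI)
  fix P assume "orthogonal_polyhedron P"
  then show "\<exists>G. finite G \<and> card G \<le> card (faces P) div 6 \<and> guarded_by_open_faces P G"
    using orthogonal_polyhedron_guarded by metis
next
  fix N :: nat
  obtain G where "finite G" "card G \<le> card (faces (rack N)) div 6" "guarded_by_open_faces (rack N) G"
    using orthogonal_polyhedron_guarded[OF rack_orthogonal_polyhedron] by metis
  \<comment> \<open>The two bounds together give
    \<open>N + 1 \<le> card (faces (rack N)) div 6\<close>, so no faces have to be
    exhibited.\<close>
  then have "N \<le> card (faces (rack N))" using rack_guards[of G N] by linarith
  moreover have "card (faces (rack N)) div 6 \<le> card G"
    if "finite G" "guarded_by_open_faces (rack N) G" for G
    using rack_guards[OF that] card_faces_rack[of N] by linarith
  ultimately show "\<exists>P. orthogonal_polyhedron P \<and> N \<le> card (faces P) \<and>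
      (\<forall>G. finite G \<and> guarded_by_open_faces P G \<longrightarrow> card (faces P) div 6 \<le> card G)"
    using rack_orthogonal_polyhedron by blast
qed

end
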